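(* Let $(x_n)_{n=1}^\infty$ be a Bessel or an outer Bessel sequence in a Hilbert $C^*$-module $X$ over a $C^*$-algebra $\mathsf{A}$, with analysis operator $U$ and optimal Bessel bound $B$. Then there is a finite extension of $(x_n)_n$ to a Parseval frame or an outer Parseval frame for $X$ if and only if there exists $\theta\in\mathbb{F}(M(X))$ such that $I-U^*U=\theta|_X$, and $B\le 1$.
   Context: $\mathsf{A}$ is an arbitrary $C^*$-algebra (not necessarily unital) with multiplier algebra $M(\mathsf{A})$. Hilbert $\mathsf{A}$-modules are right modules with inner product $\mathsf{A}$-linear in the second variable; they are not assumed full. $\mathbb{B}(X,Y)$ denotes the adjointable operators from $X$ to $Y$; $I$ is the identity operator on $X$. For a Hilbert module $Z$, $\mathbb{F}(Z)$ is the linear span of the operators $\theta_{w,z}$, $w,z\in Z$, where $\theta_{w,z}(u)=w\langle z,u\rangle$. $\ell^2(\mathsf{A})$ is the Hilbert $\mathsf{A}$-module of sequences $(a_n)_n$ in $\mathsf{A}$ with $\sum_n a_n^*a_n$ norm convergent, with inner product $\langle (a_n)_n,(b_n)_n\rangle=\sum_n a_n^*b_n$. $M(X)$ denotes the multiplier module of $X$: $M(X)=\mathbb{B}(\mathsf{A},X)$, a Hilbert $M(\mathsf{A})$-module with $\langle v,w\rangle=v^*w\in\mathbb{B}(\mathsf{A})=M(\mathsf{A})$, containing $X$ via $x\mapsto(a\mapsto xa)$, and $M(X)\mathsf{A}=X$; thus $\langle v,x\rangle\in\mathsf{A}$ for $v\in M(X)$, $x\in X$. $\mathbb{F}(M(X))$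 is formed in the Hilbert $M(\mathsf{A})$-module $M(X)$; its elements map $X$ into $X$. A sequence $(x_n)_n$ in $X$ is a Bessel sequence if there is $B>0$ with $\sum_{n=1}^\infty\langle x,x_n\rangle\langle x_n,x\rangle\le B\langle x,x\rangle$ for all $x\in X$, the series converging in norm; the optimal Bessel bound is the smallest such $B$ (equal to $\|U\|^2$). It is a Parseval frame for $X$ if $\sum_{n=1}^\infty\langle x,x_n\rangle\langle x_n,x\rangle=\langle x,x\rangle$ for all $x\in X$ (norm convergence). A sequence $(x_n)_n$ in $M(X)$ with $x_n\in M(X)\setminus X$ for at least one $n$ is an outer Bessel sequence (resp. outer Parseval frame) for $X$ if the same condition holds for all $x\in X$ with norm convergence in $\mathsf{A}$. The analysis operator of a (outer) Bessel sequence is $U\in\mathbb{B}(X,\ell^2(\mathsf{A}))$, $Ux=(\langle x_n,x\rangle)_n$. A finite extension of $(x_n)_{n=1}^\infty$ to a Parseval or outer Parseval frame for $X$ is a finite sequence $f_1,\dots,f_N\in M(X)$, $N\in\mathbb{N}$, such that $f_1,\dots,f_N,x_1,x_2,\dots$ is a Parseval frame or an outer Parseval frame for $X$. *)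

theory Defs
  imports Complex_Main "HOL-Library.Function_Algebras"
begin

section \<open>Complex Banach spaces and C*-algebras\<close>

class complex_vector = ab_group_add +
  fixes scaleC :: "complex \<Rightarrow> 'a \<Rightarrow> 'a"  (infixr \<open>*\<^sub>C\<close> 75)
  assumes scaleC_add_right: "c *\<^sub>C (x + y) = c *\<^sub>C x + c *\<^sub>C y"
    and scaleC_add_left: "(c + d) *\<^sub>C x = c *\<^sub>C x + d *\<^sub>C x"
    and scaleC_scaleC: "c *\<^sub>C d *\<^sub>C x = (c * d) *\<^sub>C x"
    and scaleC_one: "1 *\<^sub>C x = x"

global_interpretation complex_vector: vector_space "scaleC :: complex \<Rightarrow> 'a \<Rightarrow> 'a::complex_vector"
  by unfold_locales (simp_all add: scaleC_add_right scaleC_add_left scaleC_scaleC scaleC_one)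

instantiation "fun" :: (type, complex_vector) complex_vector
begin

definition scaleC_fun :: "complex \<Rightarrow> ('a \<Rightarrow> 'b) \<Rightarrow> 'a \<Rightarrow> 'b"
  where "scaleC_fun c f = (\<lambda>t. c *\<^sub>C f t)"

instance
  by standard
    (simp_all add: scaleC_fun_def fun_eq_iff scaleC_add_right scaleC_add_left scaleC_scaleC scaleC_one)

end

class complex_banach = complex_vector + banach +
  assumes scaleR_scaleC: "r *\<^sub>R x = complex_of_real r *\<^sub>C x"
    and norm_scaleC: "norm (c *\<^sub>C x) = cmod c * norm x"

text \<open>No unit is required: \<open>real_normed_algebra\<close> is the class of possibly non-unital algebras.\<close>

class cstar_algebra = complex_banach + real_normed_algebra +
  fixes star :: "'a \<Rightarrow> 'a"
  assumes mult_scaleC_left: "(c *\<^sub>C x) * y = c *\<^sub>C (x * y)"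
    and mult_scaleC_right: "x * (c *\<^sub>C y) = c *\<^sub>C (x * y)"
    and star_star: "star (star x) = x"
    and star_add: "star (x + y) = star x + star y"
    and star_scaleC: "star (c *\<^sub>C x) = cnj c *\<^sub>C star x"
    and star_mult: "star (x * y) = star y * star x"
    and norm_star_mult: "norm (star x * x) = (norm x)\<^sup>2"

definition cpos :: "'a::cstar_algebra \<Rightarrow> bool"
  where "cpos a \<longleftrightarrow> (\<exists>c. a = star c * c)"

definition cle :: "'a::cstar_algebra \<Rightarrow> 'a \<Rightarrow> bool"  (infix \<open>\<le>\<^sub>A\<close> 50)
  where "a \<le>\<^sub>A b \<longleftrightarrow> cpos (b - a)"


section \<open>Hilbert modules\<close>

text \<open>A right Hilbert module is the whole type \<open>'x\<close>, with module action \<open>act x a\<close> (written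
  \<open>xa\<close> in comments) and inner product \<open>ip\<close>. Completeness is part of the class
  \<open>complex_banach\<close>, whose norm is tied to the inner product by \<open>norm_ip\<close>.\<close>

locale hilbert_module =
  fixes act :: "'x::complex_banach \<Rightarrow> 'a::cstar_algebra \<Rightarrow> 'x"
    and ip :: "'x \<Rightarrow> 'x \<Rightarrow> 'a"
  assumes act_add_left: "act (x + y) a = act x a + act y a"
    and act_add_right: "act x (a + b) = act x a + act x b"
    and act_mult: "act x (a * b) = act (act x a) b"
    and act_scaleC_left: "act (c *\<^sub>C x) a = c *\<^sub>C act x a"
    and act_scaleC_right: "act x (c *\<^sub>C a) = c *\<^sub>C act x a"
    and ip_add_right: "ip x (y + z) = ip x y + ip x z"
    and ip_scaleC_right: "ip x (c *\<^sub>C y) = c *\<^sub>C ip x y"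
    and ip_act_right: "ip x (act y a) = ip x y * a"
    and ip_star: "star (ip x y) = ip y x"
    and ip_pos: "cpos (ip x x)"
    and ip_definite: "ip x x = 0 \<Longrightarrow> x = 0"
    and norm_ip: "norm x = sqrt (norm (ip x x))"

text \<open>Adjointability is stated for modules with explicit carriers \<open>E\<close> and \<open>F\<close>, since the
  sequence module below is a proper subset of its type. A map with an adjoint is
  automatically a bounded module homomorphism.\<close>

definition is_adjoint ::
    "'x set \<Rightarrow> ('x \<Rightarrow> 'x \<Rightarrow> 'a) \<Rightarrow> 'y set \<Rightarrow> ('y \<Rightarrow> 'y \<Rightarrow> 'a) \<Rightarrow> ('x \<Rightarrow> 'y) \<Rightarrow> ('y \<Rightarrow> 'x) \<Rightarrow> bool"
  where "is_adjoint E ipE F ipF T S \<longleftrightarrow>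
    (\<forall>x\<in>E. T x \<in> F) \<and> (\<forall>y\<in>F. S y \<in> E) \<and> (\<forall>x\<in>E. \<forall>y\<in>F. ipF (T x) y = ipE x (S y))"

definition adjointable ::
    "'x set \<Rightarrow> ('x \<Rightarrow> 'x \<Rightarrow> 'a) \<Rightarrow> 'y set \<Rightarrow> ('y \<Rightarrow> 'y \<Rightarrow> 'a) \<Rightarrow> ('x \<Rightarrow> 'y) set"
  where "adjointable E ipE F ipF = {T. \<exists>S. is_adjoint E ipE F ipF T S}"

text \<open>For adjointable maps of Hilbert modules the values of the adjoint on \<open>F\<close> are unique.\<close>

definition adjoint ::
    "'x set \<Rightarrow> ('x \<Rightarrow> 'x \<Rightarrow> 'a) \<Rightarrow> 'y set \<Rightarrow> ('y \<Rightarrow> 'y \<Rightarrow> 'a) \<Rightarrow> ('x \<Rightarrow> 'y) \<Rightarrow> 'y \<Rightarrow> 'x"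
  where "adjoint E ipE F ipF T = (SOME S. is_adjoint E ipE F ipF T S)"

definition rank_one :: "('z \<Rightarrow> 'm \<Rightarrow> 'z) \<Rightarrow> ('z \<Rightarrow> 'z \<Rightarrow> 'm) \<Rightarrow> 'z \<Rightarrow> 'z \<Rightarrow> 'z \<Rightarrow> 'z"
  where "rank_one act ip w z = (\<lambda>u. act w (ip z u))"

definition finite_rank ::
    "'z::complex_vector set \<Rightarrow> ('z \<Rightarrow> 'm \<Rightarrow> 'z) \<Rightarrow> ('z \<Rightarrow> 'z \<Rightarrow> 'm) \<Rightarrow> ('z \<Rightarrow> 'z) set"
  where "finite_rank Z act ip = complex_vector.span {rank_one act ip w z |w z. w \<in> Z \<and> z \<in> Z}"

definition alg_ip :: "'a::cstar_algebra \<Rightarrow> 'a \<Rightarrow> 'a"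
  where "alg_ip a b = star a * b"

definition ell2 :: "(nat \<Rightarrow> 'a::cstar_algebra) set"
  where "ell2 = {s. summable (\<lambda>n. star (s n) * s n)}"

definition ell2_ip :: "(nat \<Rightarrow> 'a::cstar_algebra) \<Rightarrow> (nat \<Rightarrow> 'a) \<Rightarrow> 'a"
  where "ell2_ip s t = (\<Sum>n. star (s n) * t n)"


section \<open>The multiplier module\<close>

definition mult_module :: "('x \<Rightarrow> 'x \<Rightarrow> 'a::cstar_algebra) \<Rightarrow> ('a \<Rightarrow> 'x) set"
  where "mult_module ip = adjointable UNIV alg_ip UNIV ip"

abbreviation madj :: "('x \<Rightarrow> 'x \<Rightarrow> 'a::cstar_algebra) \<Rightarrow> ('a \<Rightarrow> 'x) \<Rightarrow> 'x \<Rightarrow> 'a"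
  where "madj ip \<equiv> adjoint UNIV alg_ip UNIV ip"

text \<open>The multiplier algebra is the algebra of adjointable maps \<open>'a \<Rightarrow> 'a\<close>; it acts on the
  multiplier module by composition.\<close>

definition mult_act :: "('a \<Rightarrow> 'x) \<Rightarrow> ('a \<Rightarrow> 'a) \<Rightarrow> 'a \<Rightarrow> 'x"
  where "mult_act w m = w \<circ> m"

definition mult_ip :: "('x \<Rightarrow> 'x \<Rightarrow> 'a::cstar_algebra) \<Rightarrow> ('a \<Rightarrow> 'x) \<Rightarrow> ('a \<Rightarrow> 'x) \<Rightarrow> 'a \<Rightarrow> 'a"
  where "mult_ip ip v w = madj ip v \<circ> w"

definition mult_embed :: "('x \<Rightarrow> 'a \<Rightarrow> 'x) \<Rightarrow> 'x \<Rightarrow> 'a \<Rightarrow> 'x"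
  where "mult_embed act x = (\<lambda>a. act x a)"

text \<open>The inner product of \<open>v\<close> in the multiplier module with \<open>x\<close> in the module, as an element
  of the algebra itself. Lemmas \<open>mult_ip_embed\<close> and \<open>mult_pair_embed\<close> below show that it
  represents \<open>mult_ip\<close> by left multiplication and extends \<open>ip\<close>.\<close>

definition mult_pair :: "('x \<Rightarrow> 'x \<Rightarrow> 'a::cstar_algebra) \<Rightarrow> ('a \<Rightarrow> 'x) \<Rightarrow> 'x \<Rightarrow> 'a"
  where "mult_pair ip v x = madj ip v x"

lemma star_mult_eq_0:
  fixes a :: "'a::cstar_algebra"
  shows "star a * a = 0 \<Longrightarrow> a = 0"
  using norm_star_mult[of a] by simp

lemma alg_ip_eqI:
  fixes a b :: "'a::cstar_algebra"
  assumes "\<And>c. star c * a = star c * b"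
  shows "a = b"
  using assms[of "a - b"] star_mult_eq_0[of "a - b"] by (simp add: right_diff_distrib)

lemma madj_eqI:
  assumes "\<And>a x. ip (v a) x = star a * S x"
  shows "madj ip v = S"
proof -
  have S: "is_adjoint UNIV alg_ip UNIV ip v S"
    by (simp add: is_adjoint_def alg_ip_def assms)
  have "S' = S" if "is_adjoint UNIV alg_ip UNIV ip v S'" for S'
  proof
    fix x
    have "star a * S' x = star a * S x" for a
      using S that by (simp add: is_adjoint_def alg_ip_def)
    then show "S' x = S x" by (rule alg_ip_eqI)
  qed
  with S show ?thesis
    unfolding adjoint_def by (rule some_equality)
qed

lemma madj:
  assumes "v \<in> mult_module ip"
  shows "ip (v a) x = star a * madj ip v x"
proof -
  have "is_adjoint UNIV alg_ip UNIV ip v (madj ip v)"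
    using assms by (simp add: adjoint_def mult_module_def adjointable_def someI_ex)
  then show ?thesis by (simp add: is_adjoint_def alg_ip_def)
qed

context hilbert_module
begin

lemma ip_act_left: "ip (act x a) y = star a * ip x y"
  by (metis ip_act_right ip_star star_mult)

lemma embed_mem: "mult_embed act x \<in> mult_module ip"
  by (auto simp: mult_module_def adjointable_def is_adjoint_def alg_ip_def mult_embed_def ip_act_left
      intro!: exI[of _ "ip x"])

lemma mult_pair_embed: "mult_pair ip (mult_embed act x) y = ip x y"
  unfolding mult_pair_def by (subst madj_eqI[of ip _ "ip x"]) (simp_all add: mult_embed_def ip_act_left)

lemma mult_ip_embed:
  assumes "v \<in> mult_module ip"
  shows "mult_ip ip v (mult_embed act x) = (\<lambda>a. mult_pair ip v x * a)"
proof
  fix a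
  have "star b * madj ip v (act x a) = star b * (madj ip v x * a)" for b
    by (metis assms madj ip_act_right mult.assoc)
  then show "mult_ip ip v (mult_embed act x) a = mult_pair ip v x * a"
    by (simp add: mult_ip_def mult_pair_def mult_embed_def alg_ip_eqI)
qed

end


section \<open>Bessel sequences and Parseval frames\<close>

text \<open>All sequences live in the multiplier module; a sequence in the module is one whose terms
  lie in \<open>range (mult_embed act)\<close>. The \<open>n\<close>-th term below is the product of the inner products of
  \<open>x\<close> with \<open>v n\<close> and of \<open>v n\<close> with \<open>x\<close>. Indices start at 0.\<close>

definition frame_term :: "('x \<Rightarrow> 'x \<Rightarrow> 'a::cstar_algebra) \<Rightarrow> (nat \<Rightarrow> 'a \<Rightarrow> 'x) \<Rightarrow> 'x \<Rightarrow> nat \<Rightarrow> 'a"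
  where "frame_term ip v x n = star (mult_pair ip (v n) x) * mult_pair ip (v n) x"

definition bessel_bound :: "('x \<Rightarrow> 'x \<Rightarrow> 'a::cstar_algebra) \<Rightarrow> (nat \<Rightarrow> 'a \<Rightarrow> 'x) \<Rightarrow> real \<Rightarrow> bool"
  where "bessel_bound ip v B \<longleftrightarrow> B > 0 \<and>
    (\<forall>x. summable (frame_term ip v x) \<and> (\<Sum>n. frame_term ip v x n) \<le>\<^sub>A B *\<^sub>R ip x x)"

text \<open>An infimum rather than a minimum, so that the zero sequence gets the value 0, the
  squared norm of its analysis operator.\<close>

definition optimal_bessel_bound :: "('x \<Rightarrow> 'x \<Rightarrow> 'a::cstar_algebra) \<Rightarrow> (nat \<Rightarrow> 'a \<Rightarrow> 'x) \<Rightarrow> real"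
  where "optimal_bessel_bound ip v = Inf {B. bessel_bound ip v B}"

definition parseval_identity :: "('x \<Rightarrow> 'x \<Rightarrow> 'a::cstar_algebra) \<Rightarrow> (nat \<Rightarrow> 'a \<Rightarrow> 'x) \<Rightarrow> bool"
  where "parseval_identity ip v \<longleftrightarrow> (\<forall>x. frame_term ip v x sums ip x x)"

definition inner_seq :: "('x \<Rightarrow> 'a \<Rightarrow> 'x) \<Rightarrow> (nat \<Rightarrow> 'a \<Rightarrow> 'x) \<Rightarrow> bool"
  where "inner_seq act v \<longleftrightarrow> (\<forall>n. v n \<in> range (mult_embed act))"

definition outer_seq ::
    "('x \<Rightarrow> 'a \<Rightarrow> 'x) \<Rightarrow> ('x \<Rightarrow> 'x \<Rightarrow> 'a::cstar_algebra) \<Rightarrow> (nat \<Rightarrow> 'a \<Rightarrow> 'x) \<Rightarrow> bool"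
  where "outer_seq act ip v \<longleftrightarrow>
    (\<forall>n. v n \<in> mult_module ip) \<and> (\<exists>n. v n \<notin> range (mult_embed act))"

definition bessel_sequence ::
    "('x \<Rightarrow> 'a \<Rightarrow> 'x) \<Rightarrow> ('x \<Rightarrow> 'x \<Rightarrow> 'a::cstar_algebra) \<Rightarrow> (nat \<Rightarrow> 'a \<Rightarrow> 'x) \<Rightarrow> bool"
  where "bessel_sequence act ip v \<longleftrightarrow> inner_seq act v \<and> (\<exists>B. bessel_bound ip v B)"

definition outer_bessel_sequence ::
    "('x \<Rightarrow> 'a \<Rightarrow> 'x) \<Rightarrow> ('x \<Rightarrow> 'x \<Rightarrow> 'a::cstar_algebra) \<Rightarrow> (nat \<Rightarrow> 'a \<Rightarrow> 'x) \<Rightarrow> bool"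
  where "outer_bessel_sequence act ip v \<longleftrightarrow> outer_seq act ip v \<and> (\<exists>B. bessel_bound ip v B)"

definition parseval_frame ::
    "('x \<Rightarrow> 'a \<Rightarrow> 'x) \<Rightarrow> ('x \<Rightarrow> 'x \<Rightarrow> 'a::cstar_algebra) \<Rightarrow> (nat \<Rightarrow> 'a \<Rightarrow> 'x) \<Rightarrow> bool"
  where "parseval_frame act ip v \<longleftrightarrow> inner_seq act v \<and> parseval_identity ip v"

definition outer_parseval_frame ::
    "('x \<Rightarrow> 'a \<Rightarrow> 'x) \<Rightarrow> ('x \<Rightarrow> 'x \<Rightarrow> 'a::cstar_algebra) \<Rightarrow> (nat \<Rightarrow> 'a \<Rightarrow> 'x) \<Rightarrow> bool"
  where "outer_parseval_frame act ip v \<longleftrightarrow> outer_seq act ip v \<and> parseval_identity ip v"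

definition analysis_op :: "('x \<Rightarrow> 'x \<Rightarrow> 'a::cstar_algebra) \<Rightarrow> (nat \<Rightarrow> 'a \<Rightarrow> 'x) \<Rightarrow> 'x \<Rightarrow> nat \<Rightarrow> 'a"
  where "analysis_op ip v x = (\<lambda>n. mult_pair ip (v n) x)"

definition synthesis_op :: "('x \<Rightarrow> 'x \<Rightarrow> 'a::cstar_algebra) \<Rightarrow> (nat \<Rightarrow> 'a \<Rightarrow> 'x) \<Rightarrow> (nat \<Rightarrow> 'a) \<Rightarrow> 'x"
  where "synthesis_op ip v = adjoint UNIV ip ell2 ell2_ip (analysis_op ip v)"

definition prepend :: "nat \<Rightarrow> (nat \<Rightarrow> 'b) \<Rightarrow> (nat \<Rightarrow> 'b) \<Rightarrow> nat \<Rightarrow> 'b"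
  where "prepend N f v = (\<lambda>n. if n < N then f n else v (n - N))"

definition finite_extension ::
    "('x \<Rightarrow> 'a \<Rightarrow> 'x) \<Rightarrow> ('x \<Rightarrow> 'x \<Rightarrow> 'a::cstar_algebra) \<Rightarrow> (nat \<Rightarrow> 'a \<Rightarrow> 'x) \<Rightarrow>
      nat \<Rightarrow> (nat \<Rightarrow> 'a \<Rightarrow> 'x) \<Rightarrow> bool"
  where "finite_extension act ip v N f \<longleftrightarrow>
    (\<forall>i<N. f i \<in> mult_module ip) \<and>
    (parseval_frame act ip (prepend N f v) \<or> outer_parseval_frame act ip (prepend N f v))"

end

theory Submission imports Defs "HOL-Analysis.Analysis"
begin

text \<open>If the extension is a Parseval frame, then \<open>I - U\<^sup>*U = (\<Sum>i<N. f i (f i)\<^sup>*)\<close> by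
  polarization, and this sum is positive.  Conversely, \<open>T = I - U\<^sup>*U\<close> is positive because the Bessel
  bound is at most 1.  If \<open>T = (\<Sum>i. w i (z i)\<^sup>*)\<close>, then \<open>T \<le> (\<Sum>i. w i (w i)\<^sup>* + z i (z i)\<^sup>*) = b\<close>.
  With \<open>r = sqrt T\<close>, \<open>s = sqrt b\<close> and polynomials \<open>C n\<close> in \<open>b\<close> such that \<open>b C n\<close> tends to \<open>s\<close>, the
  operators \<open>r C n s\<close> tend to \<open>r\<close> because \<open>T \<le> b\<close>.  Hence the maps \<open>r C n (g i)\<close>, where \<open>g i\<close> runs
  through the \<open>w i\<close> and \<open>z i\<close>, converge to maps \<open>f i\<close> with \<open>T = (\<Sum>i. f i (f i)\<^sup>*)\<close>, and these extend
  the sequence.  The order of the algebra is obtained from the norm criterion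
  \<open>norm (t - T) \<le> t\<close> for positivity, which describes a convex cone, and from Fukamiya's theorem
  that every \<open>c\<^sup>*c\<close> lies in that cone.\<close>

section \<open>Square roots of operators on a Banach space\<close>

text \<open>The case \<open>h = 0\<close> of the iteration for \<open>1 - sqrt h\<close>. It
  majorizes the operator iteration when \<open>norm (id_blinfun - h) \<le> 1\<close>.\<close>

primrec rt_scal :: "nat \<Rightarrow> real" where
  "rt_scal 0 = 0"
| "rt_scal (Suc n) = (1 + (rt_scal n)\<^sup>2) / 2"

primrec rt_coeff :: "('x \<Rightarrow>\<^sub>L 'x::real_normed_vector) \<Rightarrow> nat \<Rightarrow> 'x \<Rightarrow>\<^sub>L 'x" where
  "rt_coeff h 0 = 0"
| "rt_coeff h (Suc n) =
    (1/2) *\<^sub>R (id_blinfun + (2 * rt_scal n) *\<^sub>R rt_coeff h n - (rt_coeff h n o\<^sub>L (rt_coeff h n o\<^sub>L h)))"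

text \<open>Visser's iteration \<open>y' = ((1 - h) + y\<^sup>2) / 2\<close> for \<open>y = 1 - sqrt h\<close>, started at 0. Writing
  \<open>y = rt_scal n - h * rt_coeff h n\<close> keeps an explicit factor \<open>h\<close> in the approximate root.\<close>

definition rt_compl :: "('x \<Rightarrow>\<^sub>L 'x::real_normed_vector) \<Rightarrow> nat \<Rightarrow> 'x \<Rightarrow>\<^sub>L 'x" where
  "rt_compl h n = rt_scal n *\<^sub>R id_blinfun - (h o\<^sub>L rt_coeff h n)"

text \<open>The limit is shown to exist, and to square to \<open>h\<close>, when
  \<open>norm (id_blinfun - h) \<le> 1\<close>.\<close>

definition op_root :: "('x \<Rightarrow>\<^sub>L 'x::real_normed_vector) \<Rightarrow> 'x \<Rightarrow>\<^sub>L 'x" where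
  "op_root h = lim (\<lambda>n. h o\<^sub>L rt_coeff h n)"

lemma rt_scal_bounds: "0 \<le> rt_scal n \<and> rt_scal n \<le> 1"
proof (induction n)
  case (Suc n)
  then have "(rt_scal n)\<^sup>2 \<le> 1" by (simp add: power_le_one)
  then show ?case by simp
qed simp

lemma rt_scal_mono: "rt_scal n \<le> rt_scal (Suc n)"
  using sum_squares_bound[of "rt_scal n" 1] by simp

text \<open>A bounded increasing sequence converges, and 1 is the only fixed point of the
  recursion.\<close>

lemma rt_scal_tendsto: "rt_scal \<longlonglongrightarrow> 1"
proof -
  have "Bseq rt_scal" using rt_scal_bounds by (intro BseqI'[of _ 1]) auto
  moreover have "incseq rt_scal" using rt_scal_mono by (intro incseq_SucI) auto
  ultimately obtain L where L: "rt_scal \<longlonglongrightarrow> L"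
    using Bseq_monoseq_convergent[of rt_scal] by (auto simp: monoseq_def convergent_def incseq_def)
  have "(\<lambda>n. rt_scal (Suc n)) \<longlonglongrightarrow> (1 + L\<^sup>2) / 2" using L by (auto intro!: tendsto_eq_intros)
  with LIMSEQ_Suc[OF L] have "L = (1 + L\<^sup>2) / 2" using LIMSEQ_unique by blast
  then have "(L - 1)\<^sup>2 = 0" by (simp add: power2_eq_square algebra_simps)
  with L show ?thesis by simp
qed

text \<open>Each \<open>rt_coeff h n\<close> is a polynomial in \<open>h\<close> whose coefficients
  do not depend on \<open>h\<close>. The commutation rules for roots come from here.\<close>

lemma rt_coeff_intertwine:
  fixes T :: "'x::real_normed_vector \<Rightarrow>\<^sub>L 'y::real_normed_vector"
    and h :: "'x \<Rightarrow>\<^sub>L 'x" and h' :: "'y \<Rightarrow>\<^sub>L 'y"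
  assumes "\<And>x. T (h x) = h' (T x)"
  shows "T (rt_coeff h n x) = rt_coeff h' n (T x)"
  by (induction n arbitrary: x) (simp_all add: assms blinfun.bilinear_simps)

lemma rt_coeff_commute:
  fixes h :: "'x::real_normed_vector \<Rightarrow>\<^sub>L 'x"
  shows "h (rt_coeff h n x) = rt_coeff h n (h x)"
  using rt_coeff_intertwine[of h h h] by simp

lemma rt_compl_Suc:
  fixes h :: "'x::real_normed_vector \<Rightarrow>\<^sub>L 'x"
  shows "rt_compl h (Suc n) = (1/2) *\<^sub>R ((id_blinfun - h) + (rt_compl h n o\<^sub>L rt_compl h n))"
proof (rule blinfun_eqI)
  fix x
  show "rt_compl h (Suc n) x = ((1/2) *\<^sub>R ((id_blinfun - h) + (rt_compl h n o\<^sub>L rt_compl h n))) x"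
  proof -
    let ?r = "rt_scal n" and ?c = "rt_coeff h n"
    \<comment> \<open>The square contributes its cross term in two halves; \<open>?r\<close> is
      split to match them.\<close>
    have r: "?r *\<^sub>R z = (?r / 2) *\<^sub>R z + (?r / 2) *\<^sub>R z" for z :: 'x
      by (simp add: scaleR_left_distrib[symmetric])
    have "rt_compl h (Suc n) x = (1/2) *\<^sub>R x + (?r\<^sup>2/2) *\<^sub>R x - (1/2) *\<^sub>R h x
        - ?r *\<^sub>R ?c (h x) + (1/2) *\<^sub>R ?c (?c (h (h x)))"
      by (simp add: rt_compl_def blinfun.bilinear_simps rt_coeff_commute algebra_simps add_divide_distrib)
    then show ?thesis unfolding r[of "?c (h x)"]
      by (simp add: rt_compl_def blinfun.bilinear_simps rt_coeff_commute algebra_simps power2_eq_square)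
  qed
qed

text \<open>For commuting \<open>y\<close> and \<open>z\<close> the recursion gives
  \<open>y' - z' = (y - z) (y + z) / 2\<close>, so norms and increments are dominated by those of
  \<open>rt_scal\<close>.\<close>

lemma rt_compl_bounds:
  fixes h :: "'x::real_normed_vector \<Rightarrow>\<^sub>L 'x"
  assumes h: "norm (id_blinfun - h) \<le> 1"
  shows "norm (rt_compl h n) \<le> rt_scal n"
    and "norm (rt_compl h (Suc n) - rt_compl h n) \<le> rt_scal (Suc n) - rt_scal n"
proof -
  have Y: "norm (rt_compl h n) \<le> rt_scal n" for n
  proof (induction n)
    case 0
    show ?case by (simp add: rt_compl_def)
  next
    case (Suc n)
    have "norm (rt_compl h n o\<^sub>L rt_compl h n) \<le> (rt_scal n)\<^sup>2"
      by (rule order_trans[OF norm_blinfun_compose])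
        (simp add: power2_eq_square Suc mult_mono rt_scal_bounds)
    then have "norm ((id_blinfun - h) + (rt_compl h n o\<^sub>L rt_compl h n)) \<le> 1 + (rt_scal n)\<^sup>2"
      using h norm_triangle_mono by blast
    then show ?case by (simp add: rt_compl_Suc del: scaleR_add_right)
  qed
  then show "norm (rt_compl h n) \<le> rt_scal n" .
  have comm: "rt_compl h n o\<^sub>L rt_compl h m = rt_compl h m o\<^sub>L rt_compl h n" for n m
  proof (rule blinfun_eqI)
    fix x
    have "rt_coeff h n (rt_coeff h m z) = rt_coeff h m (rt_coeff h n z)" for z
      by (rule rt_coeff_intertwine) (simp add: rt_coeff_commute)
    then show "(rt_compl h n o\<^sub>L rt_compl h m) x = (rt_compl h m o\<^sub>L rt_compl h n) x"
      by (simp add: rt_compl_def blinfun.bilinear_simps rt_coeff_commute algebra_simps)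
  qed
  show "norm (rt_compl h (Suc n) - rt_compl h n) \<le> rt_scal (Suc n) - rt_scal n"
  proof (induction n)
    case 0
    have "rt_compl h 0 = 0" by (simp add: rt_compl_def)
    then show ?case using h by (simp add: rt_compl_Suc)
  next
    case (Suc n)
    define a b where "a = rt_compl h (Suc n)" and "b = rt_compl h n"
    have "rt_compl h (Suc (Suc n)) - a = (1/2) *\<^sub>R ((id_blinfun - h) + (a o\<^sub>L a))
        - (1/2) *\<^sub>R ((id_blinfun - h) + (b o\<^sub>L b))"
      unfolding a_def b_def by (simp only: rt_compl_Suc)
    also have "\<dots> = (1/2) *\<^sub>R ((a - b) o\<^sub>L (a + b))"
      using comm[of "Suc n" n, folded a_def b_def]
      by (simp add: bounded_bilinear.diff_left[OF bounded_bilinear_blinfun_compose]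
          bounded_bilinear.add_right[OF bounded_bilinear_blinfun_compose] algebra_simps)
    finally have "norm (rt_compl h (Suc (Suc n)) - a) = norm ((a - b) o\<^sub>L (a + b)) / 2" by simp
    also have "norm ((a - b) o\<^sub>L (a + b)) \<le> (rt_scal (Suc n) - rt_scal n) * (rt_scal (Suc n) + rt_scal n)"
    proof (rule order_trans[OF norm_blinfun_compose], rule mult_mono)
      show "norm (a + b) \<le> rt_scal (Suc n) + rt_scal n"
        unfolding a_def b_def by (rule norm_triangle_mono[OF Y Y])
    qed (use Suc rt_scal_mono in \<open>auto simp: a_def b_def simp del: rt_scal.simps\<close>)
    also have "(rt_scal (Suc n) - rt_scal n) * (rt_scal (Suc n) + rt_scal n) / 2
        = (1 + (rt_scal (Suc n))\<^sup>2) / 2 - (1 + (rt_scal n)\<^sup>2) / 2"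
      by (simp add: field_simps power2_eq_square del: rt_scal.simps)
    finally show ?case unfolding a_def rt_scal.simps(2)[symmetric] by simp
  qed
qed

context
  fixes h :: "'x::banach \<Rightarrow>\<^sub>L 'x"
  assumes h: "norm (id_blinfun - h) \<le> 1"
begin

text \<open>The increments are dominated by a convergent telescoping series. The limit
  \<open>y\<close> of \<open>rt_compl h\<close> solves \<open>y = ((1 - h) + y\<^sup>2) / 2\<close>,
  that is \<open>(1 - y)\<^sup>2 = h\<close>, and \<open>1 - y\<close> is the root.\<close>

lemma op_root_tendsto: "(\<lambda>n. h o\<^sub>L rt_coeff h n) \<longlonglongrightarrow> op_root h"
  and norm_op_root_compl: "norm (id_blinfun - op_root h) \<le> 1"
  and op_root_square: "op_root h (op_root h x) = h x"
proof -
  have "summable (\<lambda>n. rt_scal (Suc n) - rt_scal n)"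
    using telescope_summable[OF rt_scal_tendsto] by simp
  then have "summable (\<lambda>n. rt_compl h (Suc n) - rt_compl h n)"
    by (rule summable_norm_cancel[OF summable_comparison_test'])
      (use rt_compl_bounds(2)[OF h] in auto)
  then have "convergent (\<lambda>n. (\<Sum>k<n. rt_compl h (Suc k) - rt_compl h k))"
    by (simp add: summable_iff_convergent)
  then have "convergent (rt_compl h)"
    by (simp add: sum_lessThan_telescope rt_compl_def[of _ 0])
  then obtain y where y: "rt_compl h \<longlonglongrightarrow> y" by (auto simp: convergent_def)
  have ny: "norm y \<le> 1"
    by (rule LIMSEQ_le_const2[OF tendsto_norm[OF y]])
      (meson h order_trans rt_compl_bounds(1) rt_scal_bounds)
  have "(\<lambda>n. rt_compl h (Suc n)) \<longlonglongrightarrow> (1/2) *\<^sub>R ((id_blinfun - h) + (y o\<^sub>L y))"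
    unfolding rt_compl_Suc
    by (intro tendsto_intros bounded_bilinear.tendsto[OF bounded_bilinear_blinfun_compose] y)
  with LIMSEQ_Suc[OF y] have yy: "y = (1/2) *\<^sub>R ((id_blinfun - h) + (y o\<^sub>L y))"
    using LIMSEQ_unique by blast
  have "(\<lambda>n. rt_scal n *\<^sub>R id_blinfun - rt_compl h n) \<longlonglongrightarrow> 1 *\<^sub>R id_blinfun - y"
    by (intro tendsto_intros y rt_scal_tendsto)
  then have lim: "(\<lambda>n. h o\<^sub>L rt_coeff h n) \<longlonglongrightarrow> id_blinfun - y" by (simp add: rt_compl_def)
  then have root: "op_root h = id_blinfun - y" unfolding op_root_def by (rule limI)
  show "(\<lambda>n. h o\<^sub>L rt_coeff h n) \<longlonglongrightarrow> op_root h" using lim root by simp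
  show "norm (id_blinfun - op_root h) \<le> 1" using ny root by simp
  have "2 *\<^sub>R y x = x - h x + y (y x)"
    using arg_cong[OF yy, of "\<lambda>T. 2 *\<^sub>R blinfun_apply T x"] by (simp add: blinfun.bilinear_simps)
  then show "op_root h (op_root h x) = h x"
    by (simp add: root blinfun.bilinear_simps scaleR_2 algebra_simps)
qed

lemma op_root_apply_tendsto: "(\<lambda>n. h (rt_coeff h n x)) \<longlonglongrightarrow> op_root h x"
  using blinfun.tendsto[OF op_root_tendsto tendsto_const, of x] by simp

end

lemma op_root_intertwine:
  fixes T :: "'x::banach \<Rightarrow>\<^sub>L 'y::banach"
    and h :: "'x \<Rightarrow>\<^sub>L 'x" and h' :: "'y \<Rightarrow>\<^sub>L 'y"
  assumes "norm (id_blinfun - h) \<le> 1" "norm (id_blinfun - h') \<le> 1"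
    and "\<And>x. T (h x) = h' (T x)"
  shows "T (op_root h x) = op_root h' (T x)"
proof (rule LIMSEQ_unique)
  show "(\<lambda>n. T (h (rt_coeff h n x))) \<longlonglongrightarrow> T (op_root h x)"
    by (intro blinfun.tendsto tendsto_const op_root_apply_tendsto assms)
  show "(\<lambda>n. T (h (rt_coeff h n x))) \<longlonglongrightarrow> op_root h' (T x)"
    using op_root_apply_tendsto[OF assms(2), of "T x"]
    by (simp add: assms(3) rt_coeff_intertwine[of T h h', OF assms(3)])
qed

section \<open>Self-adjoint and positive operators\<close>

lemma star_zero [simp]: "star (0::'a::cstar_algebra) = 0"
  using star_add[of 0 "0::'a"] by simp

lemma star_minus: "star (- x) = - star (x::'a::cstar_algebra)"
  using star_add[of x "- x"] by (simp add: eq_neg_iff_add_eq_0 add.commute)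

lemma star_diff: "star (x - y) = star x - star (y::'a::cstar_algebra)"
  using star_add[of x "- y"] by (simp add: star_minus)

lemma star_scaleR: "star (r *\<^sub>R x) = r *\<^sub>R star (x::'a::cstar_algebra)"
  by (simp add: scaleR_scaleC star_scaleC)

lemma star_sum: "star (sum f A) = (\<Sum>i\<in>A. star (f i :: 'a::cstar_algebra))"
  by (induction A rule: infinite_finite_induct) (simp_all add: star_add)

lemma norm_star [simp]: "norm (star x) = norm (x::'a::cstar_algebra)"
proof -
  have "norm y \<le> norm (star y)" for y :: 'a
  proof (cases "y = 0")
    case False
    have "norm y * norm y \<le> norm (star y) * norm y"
      using norm_mult_ineq[of "star y" y] by (simp add: norm_star_mult power2_eq_square)
    with False show ?thesis by simp
  qed simp
  from this[of x] this[of "star x"] show ?thesis by (simp add: star_star)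
qed

lemma bounded_linear_star: "bounded_linear (star :: 'a::cstar_algebra \<Rightarrow> 'a)"
  by (rule bounded_linear_intro[of _ 1]) (simp_all add: star_add star_scaleR)

lemmas tendsto_star = bounded_linear.tendsto[OF bounded_linear_star]

context hilbert_module
begin

lemma ip_add_left: "ip (x + y) z = ip x z + ip y z"
  by (metis ip_add_right ip_star star_add)

lemma ip_scaleC_left: "ip (c *\<^sub>C x) y = cnj c *\<^sub>C ip x y"
  by (metis ip_scaleC_right ip_star star_scaleC)

lemma ip_scaleR_right: "ip x (r *\<^sub>R y) = r *\<^sub>R ip x y"
  by (simp add: scaleR_scaleC ip_scaleC_right)

lemma ip_scaleR_left: "ip (r *\<^sub>R x) y = r *\<^sub>R ip x y"
  by (simp add: scaleR_scaleC ip_scaleC_left)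

lemma ip_zero_right [simp]: "ip x 0 = 0"
  using ip_add_right[of x 0 0] by simp

lemma ip_zero_left [simp]: "ip 0 x = 0"
  using ip_add_left[of 0 0 x] by simp

lemma ip_minus_right: "ip x (- y) = - ip x y"
  using ip_scaleR_right[of x "- 1" y] by simp

lemma ip_minus_left: "ip (- x) y = - ip x y"
  using ip_scaleR_left[of "- 1" x y] by simp

lemma ip_diff_right: "ip x (y - z) = ip x y - ip x z"
  using ip_add_right[of x y "- z"] by (simp add: ip_minus_right)

lemma ip_diff_left: "ip (x - y) z = ip x z - ip y z"
  using ip_add_left[of x "- y" z] by (simp add: ip_minus_left)

lemma ip_sum_right: "ip x (sum f A) = (\<Sum>i\<in>A. ip x (f i))"
  by (induction A rule: infinite_finite_induct) (simp_all add: ip_add_right)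

lemmas ip_bilinear = ip_add_left ip_add_right ip_diff_left ip_diff_right ip_scaleR_left
  ip_scaleR_right ip_minus_left ip_minus_right

lemma norm_power2_ip: "(norm x)\<^sup>2 = norm (ip x x)"
  by (simp add: norm_ip)

lemma ip_eqI: "x = y" if "\<And>z. ip z x = ip z y"
proof -
  have "ip (x - y) (x - y) = 0" using that by (simp add: ip_diff_right)
  then have "x - y = 0" by (rule ip_definite)
  then show ?thesis by simp
qed

section \<open>Self-adjoint operators and the cone of positive operators\<close>

definition sa :: "('x \<Rightarrow>\<^sub>L 'x) \<Rightarrow> bool" where
  "sa T \<longleftrightarrow> (\<forall>x y. ip (T x) y = ip x (T y))"

text \<open>Positivity of a self-adjoint operator is expressed by a norm inequality, which makes the
  positive operators a convex cone by the triangle inequality.\<close>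

definition op_pos :: "('x \<Rightarrow>\<^sub>L 'x) \<Rightarrow> bool" where
  "op_pos T \<longleftrightarrow> sa T \<and> (\<exists>t>0. norm (t *\<^sub>R id_blinfun - T) \<le> t)"

lemma saD: "sa T \<Longrightarrow> ip (T x) y = ip x (T y)"
  by (simp add: sa_def)

lemma sa_id: "sa id_blinfun"
  by (simp add: sa_def)

lemma sa_lin:
  "sa S \<Longrightarrow> sa T \<Longrightarrow> sa (S + T)" "sa S \<Longrightarrow> sa T \<Longrightarrow> sa (S - T)" "sa T \<Longrightarrow> sa (r *\<^sub>R T)" "sa T \<Longrightarrow> sa (- T)"
  by (simp_all add: sa_def blinfun.bilinear_simps ip_bilinear)

lemma sa_compose:
  assumes "sa S" "sa T" "\<And>x. S (T x) = T (S x)"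
  shows "sa (S o\<^sub>L T)"
  using assms by (simp add: sa_def)

lemma sa_rt_coeff: "sa h \<Longrightarrow> sa (rt_coeff h n)"
proof (induction n)
  case 0
  show ?case by (simp add: sa_def)
next
  case (Suc n)
  then have "sa (rt_coeff h n o\<^sub>L (rt_coeff h n o\<^sub>L h))"
    by (intro sa_compose) (simp_all add: rt_coeff_commute)
  with Suc show ?case by (auto intro!: sa_lin sa_id)
qed

lemma pos_add: "op_pos S \<Longrightarrow> op_pos T \<Longrightarrow> op_pos (S + T)"
proof -
  assume "op_pos S" "op_pos T"
  then obtain s t where st: "sa S" "sa T" "s > 0" "t > 0"
    "norm (s *\<^sub>R id_blinfun - S) \<le> s" "norm (t *\<^sub>R id_blinfun - T) \<le> t" by (auto simp: op_pos_def)
  then have "norm ((s *\<^sub>R id_blinfun - S) + (t *\<^sub>R id_blinfun - T)) \<le> s + t"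
    by (intro norm_triangle_mono)
  then show "op_pos (S + T)" unfolding op_pos_def using st sa_lin(1)
    by (auto intro!: exI[of _ "s + t"] simp: algebra_simps)
qed

lemma pos_scaleR:
  assumes "op_pos T" "c > 0"
  shows "op_pos (c *\<^sub>R T)"
proof -
  obtain t where t: "sa T" "t > 0" "norm (t *\<^sub>R id_blinfun - T) \<le> t" using assms by (auto simp: op_pos_def)
  have "norm ((c * t) *\<^sub>R id_blinfun - c *\<^sub>R T) = c * norm (t *\<^sub>R id_blinfun - T)"
    using assms(2) by (simp add: scaleR_diff_right[symmetric] flip: scaleR_scaleR)
  with t assms(2) show ?thesis by (auto simp: op_pos_def sa_lin intro!: exI[of _ "c * t"])
qed

end

text \<open>The inequality of Cauchy and Schwarz holds in every Hilbert module, but its proof needs the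
  order of the algebra, which is derived from the case of the algebra over itself.\<close>

locale hilbert_module_cs = hilbert_module act ip
  for act :: "'x::complex_banach \<Rightarrow> 'a::cstar_algebra \<Rightarrow> 'x" and ip +
  assumes cauchy_schwarz: "norm (ip x y) \<le> norm x * norm y"
begin

lemma bounded_bilinear_ip: "bounded_bilinear ip"
  by (rule bounded_bilinear.intro)
    (auto simp: ip_bilinear intro!: exI[of _ 1] cauchy_schwarz)

lemmas tendsto_ip = bounded_bilinear.tendsto[OF bounded_bilinear_ip]

lemma sa_limit:
  assumes "\<And>n. sa (T n)" "T \<longlonglongrightarrow> S"
  shows "sa S"
  unfolding sa_def
proof (intro allI)
  fix x y
  have "(\<lambda>n. ip (T n x) y) \<longlonglongrightarrow> ip (S x) y" "(\<lambda>n. ip x (T n y)) \<longlonglongrightarrow> ip x (S y)"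
    by (intro tendsto_ip blinfun.tendsto tendsto_const assms(2))+
  with assms(1) show "ip (S x) y = ip x (S y)"
    using LIMSEQ_unique by (auto simp: sa_def)
qed

lemma sa_op_root:
  assumes "norm (id_blinfun - h) \<le> 1" "sa h"
  shows "sa (op_root h)"
  by (rule sa_limit[OF _ op_root_tendsto[OF assms(1)]])
    (auto intro!: sa_compose sa_rt_coeff assms simp: rt_coeff_commute)

text \<open>The operator \<open>h + i w\<close> is a multiple of a unitary, so its real part is bounded.\<close>

lemma norm_le_of_sum_squares:
  assumes "sa h" "sa w" "\<And>x. h (w x) = w (h x)"
    and "\<And>x. h (h x) + w (w x) = t *\<^sub>R x" "t \<ge> 0"
  shows "norm (h x) \<le> sqrt t * norm x"
proof -
  have swap: "ip (w x) (h x) = ip (h x) (w x)"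
    using assms(1-3) by (simp add: saD)
  have u: "norm (h x + c *\<^sub>C w x) = sqrt t * norm x" if c: "c = \<i> \<or> c = - \<i>" for c
  proof -
    have "ip (h x + c *\<^sub>C w x) (h x + c *\<^sub>C w x)
        = ip (h x) (h x) + (c + cnj c) *\<^sub>C ip (h x) (w x) + (c * cnj c) *\<^sub>C ip (w x) (w x)"
      by (simp add: ip_add_left ip_add_right ip_scaleC_left ip_scaleC_right swap scaleC_scaleC
          scaleC_add_left scaleC_add_right)
    also have "\<dots> = ip (h x) (h x) + ip (w x) (w x)"
      using c by (auto simp: scaleC_one)
    also have "\<dots> = t *\<^sub>R ip x x"
      using assms(1,2) by (simp add: saD assms(4) flip: ip_add_right ip_scaleR_right)
    finally have "norm (h x + c *\<^sub>C w x) = sqrt (t * norm (ip x x))"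
      using \<open>t \<ge> 0\<close> by (simp add: norm_ip)
    then show ?thesis by (simp add: real_sqrt_mult norm_ip)
  qed
  have "2 *\<^sub>R h x = (h x + \<i> *\<^sub>C w x) + (h x + (- \<i>) *\<^sub>C w x)"
    by (simp add: scaleR_2 complex_vector.scale_minus_left)
  then have "2 * norm (h x) = norm ((h x + \<i> *\<^sub>C w x) + (h x + (- \<i>) *\<^sub>C w x))"
    by (metis norm_scaleR abs_numeral)
  also have "\<dots> \<le> sqrt t * norm x + sqrt t * norm x"
    by (rule norm_triangle_mono) (use u[of \<i>] u[of "- \<i>"] in auto)
  finally show ?thesis by simp
qed

text \<open>With \<open>k = h / sqrt t\<close>, the operator \<open>H = 1 - k\<^sup>2\<close> has a
  root \<open>w\<close> commuting with \<open>k\<close>. Then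
  \<open>w\<^sup>2 + k\<^sup>2 = 1\<close> makes \<open>w\<close> a contraction, and
  \<open>t - h\<^sup>2 = t w\<^sup>2\<close>.\<close>

lemma norm_diff_square_le:
  assumes "sa h" "(norm h)\<^sup>2 \<le> t" "t > 0"
  shows "norm (t *\<^sub>R id_blinfun - (h o\<^sub>L h)) \<le> t"
proof -
  define k where "k = (1 / sqrt t) *\<^sub>R h"
  define H where "H = id_blinfun - (k o\<^sub>L k)"
  have tk: "t *\<^sub>R k (k x) = h (h x)" for x
    using assms(3) by (simp add: k_def blinfun.bilinear_simps)
  have k: "sa k" unfolding k_def using assms(1) by (rule sa_lin)
  have "norm k \<le> 1" using assms by (simp add: k_def real_le_rsqrt divide_le_eq)
  then have "norm (k o\<^sub>L k) \<le> 1"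
    by (meson norm_blinfun_compose order_trans mult_le_one norm_ge_zero)
  then have H: "norm (id_blinfun - H) \<le> 1" by (simp add: H_def)
  have saH: "sa H" unfolding H_def by (intro sa_lin sa_id sa_compose k refl)
  have "k (op_root H x) = op_root H (k x)" for x
    by (rule op_root_intertwine[OF H H]) (simp add: H_def blinfun.bilinear_simps)
  moreover have "op_root H (op_root H x) + k (k x) = x" for x
    unfolding op_root_square[OF H] by (simp add: H_def blinfun.bilinear_simps)
  ultimately have w: "norm (op_root H x) \<le> norm x" for x
    using norm_le_of_sum_squares[OF sa_op_root[OF H saH] k, of 1 x] by simp
  have "norm ((t *\<^sub>R id_blinfun - (h o\<^sub>L h)) x) \<le> t * norm x" for x
  proof -
    have "(t *\<^sub>R id_blinfun - (h o\<^sub>L h)) x = t *\<^sub>R op_root H (op_root H x)"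
      unfolding op_root_square[OF H] by (simp add: H_def blinfun.bilinear_simps scaleR_diff_right tk)
    also have "norm \<dots> \<le> t * norm x" using w[of "op_root H x"] w[of x] assms(3) by simp
    finally show ?thesis .
  qed
  then show ?thesis using assms(3) by (intro norm_blinfun_bound) auto
qed

lemma pos_square: "sa h \<Longrightarrow> op_pos (h o\<^sub>L h)"
  \<comment> \<open>The summand 1 keeps the witness positive when \<open>h = 0\<close>.\<close>
  unfolding op_pos_def using norm_diff_square_le[of h "(norm h)\<^sup>2 + 1"]
  by (intro conjI exI[of _ "(norm h)\<^sup>2 + 1"] sa_compose) (auto simp: add_nonneg_pos)

text \<open>Scaling by the witness of positivity reduces this to \<open>op_root\<close>. The
  polynomials \<open>C n\<close> are exported with the root because \<open>apos_root\<close> and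
  \<open>pos_dominated_factor\<close> need approximants that contain a factor
  \<open>T\<close>.\<close>

lemma pos_root:
  assumes "op_pos T"
  obtains R C where "sa R" "op_pos R" "\<And>x. R (R x) = T x"
    "\<And>(S :: 'x \<Rightarrow>\<^sub>L 'x) x. (\<And>x. S (T x) = T (S x)) \<Longrightarrow> S (R x) = R (S x)"
    "\<And>n. sa (C n)" "(\<lambda>n. T o\<^sub>L C n) \<longlonglongrightarrow> R"
    "\<And>(S :: 'x \<Rightarrow>\<^sub>L 'x) n x. (\<And>x. S (T x) = T (S x)) \<Longrightarrow> S (C n x) = C n (S x)"
proof -
  obtain t where t: "sa T" "t > 0" "norm (t *\<^sub>R id_blinfun - T) \<le> t"
    using assms by (auto simp: op_pos_def)
  define h where "h = (1 / t) *\<^sub>R T"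
  have th: "T = t *\<^sub>R h" using t by (simp add: h_def)
  have "t * norm (id_blinfun - h) = norm (t *\<^sub>R (id_blinfun - h))" using t by simp
  also have "\<dots> \<le> t * 1" using t by (simp add: th scaleR_diff_right)
  finally have h: "norm (id_blinfun - h) \<le> 1" using t by simp
  have sah: "sa h" using t by (simp add: h_def sa_lin)
  have comm: "S (h x) = h (S x)" if "\<And>x. S (T x) = T (S x)" for S :: "'x \<Rightarrow>\<^sub>L 'x" and x
    using that by (simp add: h_def blinfun.bilinear_simps)
  let ?R = "sqrt t *\<^sub>R op_root h" and ?C = "\<lambda>n. (sqrt t / t) *\<^sub>R rt_coeff h n"
  show ?thesis
  proof
    show R: "sa ?R" by (intro sa_lin sa_op_root h sah)
    have "norm (sqrt t *\<^sub>R id_blinfun - ?R) = sqrt t * norm (id_blinfun - op_root h)"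
      using t by (simp flip: scaleR_diff_right)
    with R t norm_op_root_compl[OF h] show "op_pos ?R"
      unfolding op_pos_def by (auto intro!: exI[of _ "sqrt t"] mult_left_le)
    show "?R (?R x) = T x" for x
      using t by (simp add: blinfun.bilinear_simps op_root_square[OF h] th)
    show "S (?R x) = ?R (S x)" if "\<And>x. S (T x) = T (S x)" for S :: "'x \<Rightarrow>\<^sub>L 'x" and x
      using op_root_intertwine[OF h h, of S x] comm[OF that] by (simp add: blinfun.bilinear_simps)
    show "sa (?C n)" for n by (intro sa_lin sa_rt_coeff sah)
    have "(\<lambda>n. sqrt t *\<^sub>R (h o\<^sub>L rt_coeff h n)) \<longlonglongrightarrow> ?R"
      by (intro tendsto_intros op_root_tendsto h)
    moreover have "T o\<^sub>L ?C n = sqrt t *\<^sub>R (h o\<^sub>L rt_coeff h n)" for n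
      using t by (intro blinfun_eqI) (simp add: th blinfun.bilinear_simps)
    ultimately show "(\<lambda>n. T o\<^sub>L ?C n) \<longlonglongrightarrow> ?R" by simp
    show "S (?C n x) = ?C n (S x)" if "\<And>x. S (T x) = T (S x)" for S :: "'x \<Rightarrow>\<^sub>L 'x" and n x
      using rt_coeff_intertwine[of S h h n x] comm[OF that] by (simp add: blinfun.bilinear_simps)
  qed
qed

text \<open>Every positive \<open>t\<close> above the norm can serve in \<open>op_pos\<close>, so
  one \<open>t\<close> serves a whole bounded sequence. By Cauchy-Schwarz the root of
  \<open>T\<close> has squared norm at most \<open>t\<close>, and \<open>norm_diff_square_le\<close>
  applies.\<close>

lemma pos_norm_bound:
  assumes "op_pos T" "norm T \<le> t" "t > 0"
  shows "norm (t *\<^sub>R id_blinfun - T) \<le> t"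
proof -
  obtain R where R: "sa R" "\<And>x. R (R x) = T x" using pos_root[OF assms(1)] by metis
  have "norm (R x) \<le> sqrt t * norm x" for x
  proof -
    have "(norm (R x))\<^sup>2 = norm (ip x (T x))" by (simp add: norm_power2_ip saD[OF R(1)] R(2))
    also have "\<dots> \<le> norm x * norm (T x)" by (rule cauchy_schwarz)
    also have "\<dots> \<le> norm x * (t * norm x)"
      by (intro mult_left_mono order_trans[OF norm_blinfun] mult_right_mono assms) auto
    also have "\<dots> = (sqrt t * norm x)\<^sup>2" using assms(3) by (simp add: power2_eq_square algebra_simps)
    finally show ?thesis by (rule power2_le_imp_le) (use assms(3) in simp)
  qed
  then have "norm R \<le> sqrt t" using assms(3) by (intro norm_blinfun_bound) auto
  then have "(norm R)\<^sup>2 \<le> t" using assms(3) by (metis norm_ge_zero power_mono real_sqrt_pow2 less_imp_le)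
  moreover have "R o\<^sub>L R = T" by (rule blinfun_eqI) (simp add: R)
  ultimately show ?thesis using norm_diff_square_le[OF R(1)] assms(3) by auto
qed

text \<open>The roots \<open>k\<close> of \<open>T\<close> and \<open>l\<close> of
  \<open>- T\<close> commute and satisfy \<open>k\<^sup>2 + l\<^sup>2 = 0\<close>, so
  \<open>norm_le_of_sum_squares\<close> with \<open>t = 0\<close> gives
  \<open>k = 0\<close>.\<close>

lemma pos_antisym:
  assumes "op_pos T" "op_pos (- T)"
  shows "T = 0"
proof -
  obtain k where k: "sa k" "\<And>x. k (k x) = T x"
    "\<And>(S :: 'x \<Rightarrow>\<^sub>L 'x) x. (\<And>x. S (T x) = T (S x)) \<Longrightarrow> S (k x) = k (S x)"
    using pos_root[OF assms(1)] by metis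
  obtain l where l: "sa l" "\<And>x. l (l x) = (- T) x"
    "\<And>(S :: 'x \<Rightarrow>\<^sub>L 'x) x. (\<And>x. S ((- T) x) = (- T) (S x)) \<Longrightarrow> S (l x) = l (S x)"
    using pos_root[OF assms(2)] by metis
  have "k (l x) = l (k x)" for x
    by (rule l(3)) (simp add: blinfun.bilinear_simps flip: k(2))
  then have "k x = 0" for x
    using norm_le_of_sum_squares[OF k(1) l(1), of 0 x] by (simp add: k l(2) blinfun.bilinear_simps)
  then show ?thesis by (intro blinfun_eqI) (simp flip: k(2))
qed

text \<open>The roots of \<open>Q\<close> and \<open>t - Q\<close> commute and their squares add up
  to \<open>t\<close>, which bounds the root of \<open>Q\<close> by \<open>sqrt t\<close>.\<close>

lemma norm_le_of_pos:
  assumes "op_pos Q" "op_pos (t *\<^sub>R id_blinfun - Q)" "t \<ge> 0"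
  shows "norm Q \<le> t"
proof -
  obtain q where q: "sa q" "\<And>x. q (q x) = Q x"
    "\<And>(S :: 'x \<Rightarrow>\<^sub>L 'x) x. (\<And>x. S (Q x) = Q (S x)) \<Longrightarrow> S (q x) = q (S x)"
    using pos_root[OF assms(1)] by metis
  obtain l where l: "sa l" "\<And>x. l (l x) = (t *\<^sub>R id_blinfun - Q) x"
    "\<And>(S :: 'x \<Rightarrow>\<^sub>L 'x) x. (\<And>x. S ((t *\<^sub>R id_blinfun - Q) x) = (t *\<^sub>R id_blinfun - Q) (S x)) \<Longrightarrow> S (l x) = l (S x)"
    using pos_root[OF assms(2)] by metis
  have "q (l x) = l (q x)" for x
    by (rule l(3)) (simp add: blinfun.bilinear_simps flip: q(2))
  then have *: "norm (q x) \<le> sqrt t * norm x" for x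
    using norm_le_of_sum_squares[OF q(1) l(1), of t x] assms(3) by (simp add: q l(2) blinfun.bilinear_simps)
  have "norm (Q x) \<le> t * norm x" for x
  proof -
    have "norm (Q x) \<le> sqrt t * norm (q x)" using *[of "q x"] by (simp add: q)
    also have "\<dots> \<le> sqrt t * (sqrt t * norm x)" using assms(3) by (intro mult_left_mono *) auto
    finally show ?thesis using assms(3) by (simp flip: mult.assoc)
  qed
  then show ?thesis using assms(3) by (intro norm_blinfun_bound) auto
qed

lemma sa_cube_eq_0:
  assumes "sa m" "\<And>x. m (m (m x)) = 0"
  shows "m = 0"
proof -
  have "m (m x) = 0" for x
    using norm_power2_ip[of "m (m x)"] assms(2)[of "x"] by (simp add: saD[OF assms(1)] blinfun.bilinear_simps)
  then have "m x = 0" for x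
    using norm_power2_ip[of "m x"] by (simp add: saD[OF assms(1)])
  then show ?thesis by (intro blinfun_eqI) simp
qed

text \<open>With \<open>m = q - r\<close>, commutation gives \<open>m (q + r) = 0\<close>. Since
  \<open>m\<close> commutes with the roots of \<open>q\<close> and \<open>r\<close>, the operators
  \<open>m m q\<close> and \<open>m m r\<close> are squares of self-adjoint operators. Their sum is
  0, so both vanish by antisymmetry, and \<open>m m m = 0\<close>.\<close>

lemma pos_root_unique:
  assumes "op_pos q" "op_pos r" "\<And>x. q (q x) = r (r x)" "\<And>x. q (r x) = r (q x)"
  shows "q = r"
proof -
  define m where "m = q - r"
  have m: "sa m" using assms by (simp add: m_def op_pos_def sa_lin)
  obtain s where s: "sa s" "\<And>x. s (s x) = q x"
    "\<And>(S :: 'x \<Rightarrow>\<^sub>L 'x) x. (\<And>x. S (q x) = q (S x)) \<Longrightarrow> S (s x) = s (S x)"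
    using pos_root[OF assms(1)] by metis
  obtain u where u: "sa u" "\<And>x. u (u x) = r x"
    "\<And>(S :: 'x \<Rightarrow>\<^sub>L 'x) x. (\<And>x. S (r x) = r (S x)) \<Longrightarrow> S (u x) = u (S x)"
    using pos_root[OF assms(2)] by metis
  have mq: "m (q x) = q (m x)" and mr: "m (r x) = r (m x)" for x
    by (simp_all add: m_def blinfun.bilinear_simps assms(4))
  have ms: "m (s x) = s (m x)" and mu: "m (u x) = u (m x)" for x
    using s(3)[of m] u(3)[of m] mq mr by auto
  define X where "X = (m o\<^sub>L s) o\<^sub>L (m o\<^sub>L s)"
  define Y where "Y = (m o\<^sub>L u) o\<^sub>L (m o\<^sub>L u)"
  have X: "X x = m (m (q x))" and Y: "Y x = m (m (r x))" for x
    by (simp_all add: X_def Y_def s(2) u(2) flip: ms mu)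
  have pos: "op_pos X" "op_pos Y" unfolding X_def Y_def by (intro pos_square sa_compose m s u ms mu)+
  have "q (q x) + q (r x) = r (q x) + r (r x)" for x by (simp add: assms(3,4))
  then have "m (q x) + m (r x) = 0" for x
    by (simp add: m_def blinfun.bilinear_simps algebra_simps)
  then have "m (m (q x)) + m (m (r x)) = 0" for x
    using blinfun.add_right[of m] by (metis blinfun.zero_right)
  then have "X + Y = 0" by (intro blinfun_eqI) (simp add: X Y blinfun.bilinear_simps)
  then have "Y = - X" by (simp add: eq_neg_iff_add_eq_0 add.commute)
  with pos pos_antisym[of X] have "X = 0" "Y = 0" by auto
  then have "m (m (q x)) = 0" "m (m (r x)) = 0" for x by (metis X Y zero_blinfun.rep_eq)+
  then have "m (m (m x)) = 0" for x by (simp add: m_def blinfun.bilinear_simps)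
  then have "m = 0" by (rule sa_cube_eq_0[OF m])
  then show ?thesis by (simp add: m_def)
qed

text \<open>\<open>op_root\<close> already transports intertwining. After scaling by a common
  \<open>t\<close>, uniqueness identifies the roots of \<open>p\<^sup>2 / t\<close> and
  \<open>q\<^sup>2 / t\<close> with multiples of \<open>p\<close> and \<open>q\<close>.\<close>

lemma pos_intertwine:
  fixes S :: "'x \<Rightarrow>\<^sub>L 'x"
  assumes "op_pos p" "op_pos q" "\<And>x. S (q (q x)) = p (p (S x))"
  shows "S (q x) = p (S x)"
proof -
  define t where "t = (norm p)\<^sup>2 + (norm q)\<^sup>2 + 1"
  have t: "t > 0" by (simp add: t_def add_nonneg_pos)
  have root: "norm (id_blinfun - (1 / t) *\<^sub>R (r o\<^sub>L r)) \<le> 1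
      \<and> op_root ((1 / t) *\<^sub>R (r o\<^sub>L r)) = (1 / sqrt t) *\<^sub>R r"
    if r: "op_pos r" "(norm r)\<^sup>2 \<le> t" for r
  proof -
    define h where "h = (1 / t) *\<^sub>R (r o\<^sub>L r)"
    have "t * norm (id_blinfun - h) = norm (t *\<^sub>R (id_blinfun - h))" using t by simp
    also have "\<dots> = norm (t *\<^sub>R id_blinfun - (r o\<^sub>L r))" using t by (simp add: h_def scaleR_diff_right)
    also have "\<dots> \<le> t" using r t by (intro norm_diff_square_le) (auto simp: op_pos_def)
    finally have h: "norm (id_blinfun - h) \<le> 1" using t by simp
    have sah: "sa h" using r by (auto simp: h_def op_pos_def intro!: sa_lin sa_compose)
    have "op_root h = (1 / sqrt t) *\<^sub>R r"
    proof (rule pos_root_unique)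
      show "op_pos (op_root h)"
        unfolding op_pos_def using norm_op_root_compl[OF h] sa_op_root[OF h sah]
        by (auto intro!: exI[of _ 1])
      show "op_pos ((1 / sqrt t) *\<^sub>R r)" using r t by (simp add: pos_scaleR)
      show "op_root h (op_root h x) = ((1 / sqrt t) *\<^sub>R r) (((1 / sqrt t) *\<^sub>R r) x)" for x
        unfolding op_root_square[OF h] using t by (simp add: h_def blinfun.bilinear_simps)
      have "r (op_root h x) = op_root h (r x)" for x
        by (rule op_root_intertwine[OF h h]) (simp add: h_def blinfun.bilinear_simps)
      then show "op_root h (((1 / sqrt t) *\<^sub>R r) x) = ((1 / sqrt t) *\<^sub>R r) (op_root h x)" for x
        by (simp add: blinfun.bilinear_simps)
    qed
    with h show ?thesis by (simp add: h_def)
  qed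
  have rp: "norm (id_blinfun - (1 / t) *\<^sub>R (p o\<^sub>L p)) \<le> 1"
      "op_root ((1 / t) *\<^sub>R (p o\<^sub>L p)) = (1 / sqrt t) *\<^sub>R p"
    using root[OF assms(1)] by (auto simp: t_def)
  have rq: "norm (id_blinfun - (1 / t) *\<^sub>R (q o\<^sub>L q)) \<le> 1"
      "op_root ((1 / t) *\<^sub>R (q o\<^sub>L q)) = (1 / sqrt t) *\<^sub>R q"
    using root[OF assms(2)] by (auto simp: t_def)
  have "S (((1 / sqrt t) *\<^sub>R q) x) = ((1 / sqrt t) *\<^sub>R p) (S x)"
    using op_root_intertwine[OF rq(1) rp(1), of S x] assms(3)
    by (simp add: rp(2) rq(2) blinfun.bilinear_simps)
  then show ?thesis using t by (simp add: blinfun.bilinear_simps)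
qed

end

section \<open>The order of a C*-algebra\<close>

text \<open>Here Cauchy-Schwarz is submultiplicativity of the norm, so the operator theory above is
  available before anything is known about the order.\<close>

global_interpretation alg: hilbert_module_cs "(*) :: 'a::cstar_algebra \<Rightarrow> 'a \<Rightarrow> 'a" alg_ip
proof
  fix a b c :: 'a and r :: complex
  show "norm (alg_ip a b) \<le> norm a * norm b"
    using norm_mult_ineq[of "star a" b] by (simp add: alg_ip_def)
  show "cpos (alg_ip a a)" by (auto simp: cpos_def alg_ip_def)
  show "alg_ip a a = 0 \<Longrightarrow> a = 0" unfolding alg_ip_def by (rule star_mult_eq_0)
qed (simp_all add: alg_ip_def algebra_simps mult_scaleC_left mult_scaleC_right star_mult star_star
    norm_star_mult)

section \<open>The algebra as operators of left multiplication\<close>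

abbreviation lmul :: "'a::cstar_algebra \<Rightarrow> 'a \<Rightarrow>\<^sub>L 'a" where
  "lmul \<equiv> blinfun_mult_right"

lemma lmul_apply: "lmul a x = a * x"
  by (simp add: blinfun_mult_right.rep_eq)

text \<open>Without a unit, the lower bound comes from testing on \<open>star a\<close>.\<close>

lemma norm_lmul: "norm (lmul a) = norm a"
proof (rule antisym)
  show "norm (lmul a) \<le> norm a"
    by (intro norm_blinfun_bound) (simp_all add: lmul_apply norm_mult_ineq)
  have "norm a * norm a = norm (lmul a (star a))"
    using norm_star_mult[of "star a"] by (simp add: lmul_apply star_star power2_eq_square)
  also have "\<dots> \<le> norm (lmul a) * norm a" using norm_blinfun[of "lmul a" "star a"] by simp
  finally show "norm a \<le> norm (lmul a)" by (cases "a = 0") auto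
qed

lemma lmul_lin:
  "lmul (a + b) = lmul a + lmul b" "lmul (a - b) = lmul a - lmul b" "lmul (- a) = - lmul a"
  "lmul (r *\<^sub>R a) = r *\<^sub>R lmul a" "lmul (a * b) = lmul a o\<^sub>L lmul b"
  by (rule blinfun_eqI; simp add: lmul_apply blinfun.bilinear_simps algebra_simps)+

lemma lmul_inject: "lmul a = lmul b \<longleftrightarrow> a = b"
  using norm_lmul[of "a - b"] by (auto simp: lmul_lin)

lemma sa_lmul: "alg.sa (lmul a) \<longleftrightarrow> star a = a"
proof
  assume "alg.sa (lmul a)"
  then have "star x * (star a * y) = star x * (a * y)" for x y
    by (simp add: alg.sa_def alg_ip_def lmul_apply star_mult mult.assoc)
  then have "star a * y = a * y" for y by (rule alg_ip_eqI)
  then have "lmul (star a) = lmul a" by (intro blinfun_eqI) (simp add: lmul_apply)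
  then show "star a = a" by (simp add: lmul_inject)
qed (simp add: alg.sa_def alg_ip_def lmul_apply star_mult mult.assoc)

text \<open>An intermediate notion of positivity that inherits closure under sums from operators;
  \<open>cpos_iff_apos\<close> identifies it with \<open>cpos\<close>.\<close>

definition apos :: "'a::cstar_algebra \<Rightarrow> bool" where
  "apos a \<longleftrightarrow> alg.op_pos (lmul a)"

lemma apos_star: "apos a \<Longrightarrow> star a = a"
  by (auto simp: apos_def alg.op_pos_def sa_lmul)

text \<open>The operator root must be shown to be a left multiplication. The polynomials
  \<open>C n\<close> commute with right multiplications, so \<open>lmul a o\<^sub>L C n\<close> is
  \<open>lmul (C n a)\<close>. As \<open>lmul\<close> is isometric, the elements
  \<open>C n a\<close> converge, and their limit is \<open>p\<close>.\<close>

lemma apos_root: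
  assumes "apos a"
  obtains p where "star p = p" "apos p" "p * p = a" "\<And>b. a * b = b * a \<Longrightarrow> p * b = b * p"
proof (rule alg.pos_root[OF assms[unfolded apos_def]])
  fix R C
  assume R: "alg.sa R" "alg.op_pos R" "\<And>x. R (R x) = lmul a x"
    "\<And>(S :: 'a \<Rightarrow>\<^sub>L 'a) x. (\<And>x. S (lmul a x) = lmul a (S x)) \<Longrightarrow> S (R x) = R (S x)"
    "\<And>n. alg.sa (C n)" "(\<lambda>n. lmul a o\<^sub>L C n) \<longlonglongrightarrow> R"
    "\<And>(S :: 'a \<Rightarrow>\<^sub>L 'a) n x. (\<And>x. S (lmul a x) = lmul a (S x)) \<Longrightarrow> S (C n x) = C n (S x)"
  have "lmul a o\<^sub>L C n = lmul (C n a)" for n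
  proof (rule blinfun_eqI)
    fix x
    have "C n a * x = C n (a * x)"
      using R(7)[of "blinfun_mult_left x" n a] by (simp add: lmul_apply mult.assoc)
    moreover have "a * C n x = C n (a * x)"
      using R(7)[of "lmul a" n x] by (simp add: lmul_apply)
    ultimately show "(lmul a o\<^sub>L C n) x = lmul (C n a) x" by (simp add: lmul_apply)
  qed
  then have lim: "(\<lambda>n. lmul (C n a)) \<longlonglongrightarrow> R" using R(6) by simp
  then have "Cauchy (\<lambda>n. lmul (C n a))" by (rule LIMSEQ_imp_Cauchy)
  then have "Cauchy (\<lambda>n. C n a)"
    by (simp add: Cauchy_def dist_norm norm_lmul flip: lmul_lin)
  then obtain p where p: "(\<lambda>n. C n a) \<longlonglongrightarrow> p" by (auto simp: Cauchy_convergent_iff convergent_def)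
  have "(\<lambda>n. lmul (C n a)) \<longlonglongrightarrow> lmul p"
    by (rule bounded_linear.tendsto[OF bounded_linear_blinfun_mult_right p])
  with lim have Rp: "R = lmul p" by (rule LIMSEQ_unique)
  have "star p = p" "apos p" using R(1,2) by (simp_all add: apos_def Rp sa_lmul)
  moreover have "p * p = a"
    using R(3) by (subst lmul_inject[symmetric], intro blinfun_eqI) (simp add: lmul_lin Rp)
  moreover have "p * b = b * p" if "a * b = b * a" for b
  proof -
    have "lmul b (R x) = R (lmul b x)" for x
      by (rule R(4)) (simp add: lmul_apply that flip: mult.assoc)
    then have "lmul (p * b) = lmul (b * p)" by (intro blinfun_eqI) (simp add: Rp lmul_lin)
    then show ?thesis by (simp add: lmul_inject)
  qed
  ultimately show ?thesis by (rule that)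
qed

lemma apos_square: "star h = h \<Longrightarrow> apos (h * h)"
  by (simp add: apos_def lmul_lin alg.pos_square sa_lmul)

lemma apos_add: "apos a \<Longrightarrow> apos b \<Longrightarrow> apos (a + b)"
  by (simp add: apos_def lmul_lin alg.pos_add)

lemma apos_scaleR: "apos a \<Longrightarrow> r > 0 \<Longrightarrow> apos (r *\<^sub>R a)"
  by (simp add: apos_def lmul_lin alg.pos_scaleR)

lemma apos_intertwine:
  assumes "apos p" "apos q" "d * (q * q) = p * p * d"
  shows "d * q = p * d"
proof -
  have "lmul d (lmul q x) = lmul p (lmul d x)" for x
    using assms by (intro alg.pos_intertwine) (simp_all add: apos_def lmul_apply mult.assoc[symmetric])
  then have "lmul (d * q) = lmul (p * d)" by (intro blinfun_eqI) (simp add: lmul_lin)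
  then show ?thesis by (simp add: lmul_inject)
qed

text \<open>Here \<open>d\<close> intertwines the squares of \<open>q = - d\<^sup>*d\<close> and \<open>p = dd\<^sup>*\<close>, which is positive because
  \<open>dd\<^sup>* + d\<^sup>*d\<close> is a sum of squares. So \<open>d q = p d\<close> by uniqueness of roots, while \<open>d q = - p d\<close>.\<close>

lemma apos_neg_star_mult_eq_0:
  assumes "apos (- (star d * d))"
  shows "d = 0"
proof -
  \<comment> \<open>\<open>X\<close> and \<open>Y\<close> are self-adjoint multiples of the real and
    imaginary parts of \<open>d\<close>. In the sum of their squares the terms \<open>d * d\<close>
    and \<open>star d * star d\<close> cancel.\<close>
  define X where "X = d + star d"
  define Y where "Y = \<i> *\<^sub>C (d - star d)"
  have "star X = X" by (simp add: X_def star_add star_star add.commute)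
  moreover have "star Y = Y"
    by (simp add: Y_def star_scaleC star_diff star_star complex_vector.scale_minus_left
        complex_vector.scale_right_diff_distrib)
  moreover have "X * X + Y * Y = 2 *\<^sub>R (d * star d + star d * d)"
    by (simp add: X_def Y_def mult_scaleC_left mult_scaleC_right scaleC_scaleC scaleC_one
        complex_vector.scale_minus_left scaleR_2 algebra_simps)
  ultimately have "apos (d * star d + star d * d)"
    using apos_scaleR[OF apos_add[OF apos_square apos_square], of X Y "1/2"] by simp
  from apos_add[OF this assms] have p: "apos (d * star d)" by simp
  have "d * (- (star d * d)) = d * star d * d"
    by (rule apos_intertwine[OF p assms]) (simp add: mult.assoc)
  then have "- (d * (star d * d)) = d * (star d * d)" by (simp add: mult.assoc)
  then have "2 *\<^sub>R (d * (star d * d)) = 0" unfolding scaleR_2 by (metis add.left_inverse)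
  then have "d * (star d * d) = 0" by simp
  then have "star (star d * d) * (star d * d) = 0" by (simp add: star_mult star_star mult.assoc)
  then show ?thesis by (blast intro: star_mult_eq_0)
qed

text \<open>With \<open>h = c\<^sup>*c\<close> and \<open>k = \<bar>h\<bar>\<close>, the element \<open>m = k - h\<close> is twice the negative part of \<open>h\<close>;
  \<open>(c m)\<^sup>*(c m) = - m k m\<close> forces \<open>c m = 0\<close> and then \<open>m = 0\<close>.\<close>

lemma apos_star_mult: "apos (star c * c)"
proof -
  define h where "h = star c * c"
  have h: "star h = h" by (simp add: h_def star_mult star_star)
  obtain k where k: "star k = k" "apos k" "k * k = h * h" "\<And>b. h * h * b = b * (h * h) \<Longrightarrow> k * b = b * k"
    using apos_root[OF apos_square[OF h]] by metis
  have kh: "k * h = h * k" by (rule k(4)) (simp add: mult.assoc)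
  define m where "m = k - h"
  have m: "star m = m" by (simp add: m_def star_diff h k)
  have hm: "h * m = - (k * m)" by (simp add: m_def algebra_simps kh k(3))
  \<comment> \<open>The root \<open>l\<close> of \<open>k\<close> commutes with \<open>m\<close>,
    which makes \<open>m * k * m\<close> the square of the self-adjoint
    \<open>l * m\<close>.\<close>
  obtain l where l: "star l = l" "l * l = k" "\<And>b. k * b = b * k \<Longrightarrow> l * b = b * l"
    using apos_root[OF k(2)] by metis
  have lm: "l * m = m * l" by (rule l(3)) (simp add: m_def algebra_simps kh)
  have mkm: "m * k * m = (l * m) * (l * m)"
    by (metis l(2) lm mult.assoc)
  have sd: "star (c * m) * (c * m) = - (m * k * m)"
    using hm by (simp add: star_mult m h_def mult.assoc)
  have "c * m = 0"
    by (rule apos_neg_star_mult_eq_0)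
      (unfold sd mkm minus_minus, simp add: apos_square star_mult l(1) m lm)
  with sd have 1: "m * k * m = 0" by simp
  have "m * m * m = m * k * m - m * (h * m)" by (simp add: m_def algebra_simps)
  also have "\<dots> = 0" using 1 hm by (simp add: mult.assoc)
  finally have "lmul m (lmul m (lmul m x)) = 0" for x
    by (simp add: lmul_apply mult.assoc[symmetric])
  then have "lmul m = 0" by (intro alg.sa_cube_eq_0) (simp_all add: sa_lmul m)
  then have "m = 0" using norm_lmul[of m] by simp
  with k(2) show ?thesis by (simp add: m_def h_def)
qed

section \<open>The positive cone of the algebra and its norm estimates\<close>

lemma cpos_iff_apos: "cpos a \<longleftrightarrow> apos a"
  by (metis apos_root apos_star_mult cpos_def)

lemma cpos_star_mult: "cpos (star a * a)"
  by (auto simp: cpos_def)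

lemma cpos_add: "cpos a \<Longrightarrow> cpos b \<Longrightarrow> cpos (a + b)"
  by (simp add: cpos_iff_apos apos_add)

lemma cpos_0 [simp]: "cpos (0::'a::cstar_algebra)"
  using cpos_star_mult[of "0::'a"] by simp

lemma cpos_sum: "(\<And>i. i \<in> A \<Longrightarrow> cpos (f i)) \<Longrightarrow> cpos (sum f A)"
  by (induction A rule: infinite_finite_induct) (auto intro: cpos_add)

lemma cpos_scaleR: "cpos a \<Longrightarrow> 0 \<le> r \<Longrightarrow> cpos (r *\<^sub>R a)"
  by (cases "r = 0", simp, simp add: cpos_iff_apos apos_scaleR)

lemma cpos_star: "cpos a \<Longrightarrow> star a = a"
  by (simp add: cpos_iff_apos apos_star)

text \<open>A bound \<open>K\<close> for the whole sequence is a common witness by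
  \<open>pos_norm_bound\<close>, and a norm inequality with fixed \<open>K\<close> survives the
  limit.\<close>

lemma cpos_limit:
  assumes "f \<longlonglongrightarrow> a" "\<And>n. cpos (f n)"
  shows "cpos a"
proof -
  obtain K where K: "K > 0" "\<And>n. norm (f n) \<le> K"
    using convergent_imp_Bseq[OF convergentI[OF assms(1)]] by (auto simp: Bseq_def)
  have lim: "(\<lambda>n. lmul (f n)) \<longlonglongrightarrow> lmul a"
    by (rule bounded_linear.tendsto[OF bounded_linear_blinfun_mult_right assms(1)])
  have p: "alg.op_pos (lmul (f n))" for n using assms(2) by (simp add: cpos_iff_apos apos_def)
  have "norm (K *\<^sub>R id_blinfun - lmul (f n)) \<le> K" for n
    using p K by (intro alg.pos_norm_bound) (auto simp: norm_lmul)
  then have "norm (K *\<^sub>R id_blinfun - lmul a) \<le> K"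
    by (intro LIMSEQ_le_const2[OF tendsto_norm[OF tendsto_diff[OF tendsto_const lim]]]) auto
  moreover have "alg.sa (lmul a)"
    using p by (intro alg.sa_limit[OF _ lim]) (auto simp: alg.op_pos_def)
  ultimately show ?thesis using K by (auto simp: cpos_iff_apos apos_def alg.op_pos_def)
qed

text \<open>The algebra may lack a unit, so \<open>norm b - b\<close> is formed as an operator on
  it. With witness \<open>norm b\<close> the operator to be estimated is \<open>lmul b\<close>
  itself.\<close>

lemma pos_norm_minus:
  assumes "cpos b" "b \<noteq> 0"
  shows "alg.op_pos (norm b *\<^sub>R id_blinfun - lmul b)"
  unfolding alg.op_pos_def using assms cpos_star[OF assms(1)]
  by (auto intro!: exI[of _ "norm b"] alg.sa_lin alg.sa_id simp: sa_lmul norm_lmul)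

text \<open>The operator \<open>norm b - a\<close> is the sum of the positive
  \<open>norm b - b\<close> and \<open>b - a\<close>, so \<open>norm_le_of_pos\<close>
  applies.\<close>

lemma cpos_norm_mono:
  assumes "cpos a" "cpos (b - a)"
  shows "norm a \<le> norm b"
proof -
  have b: "cpos b" using cpos_add[OF assms] by simp
  have "alg.op_pos (norm b *\<^sub>R id_blinfun - lmul a)"
  proof (cases "b = 0")
    case True
    then show ?thesis using assms by (simp add: cpos_iff_apos apos_def lmul_lin)
  next
    case False
    have "alg.op_pos ((norm b *\<^sub>R id_blinfun - lmul b) + lmul (b - a))"
      using assms(2) by (intro alg.pos_add pos_norm_minus[OF b False]) (simp add: cpos_iff_apos apos_def)
    then show ?thesis by (simp add: lmul_lin)
  qed
  then have "norm (lmul a) \<le> norm b"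
    using assms(1) by (intro alg.norm_le_of_pos) (auto simp: cpos_iff_apos apos_def)
  then show ?thesis by (simp add: norm_lmul)
qed

text \<open>With \<open>w\<close> a root of the operator \<open>norm c - c\<close>, the element is
  \<open>star (w a) * w a\<close>.\<close>

lemma cpos_conj_le:
  assumes "cpos c"
  shows "cpos (norm c *\<^sub>R (star a * a) - star a * c * a)"
proof (cases "c = 0")
  case False
  obtain w where w: "alg.sa w" "\<And>x. w (w x) = (norm c *\<^sub>R id_blinfun - lmul c) x"
    using alg.pos_root[OF pos_norm_minus[OF assms False]] by metis
  have "star (w a) * w a = norm c *\<^sub>R (star a * a) - star a * c * a"
    using alg.saD[OF w(1), of a "w a"]
    by (simp add: alg_ip_def w(2) lmul_apply blinfun.bilinear_simps algebra_simps)
  then show ?thesis by (metis cpos_star_mult)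
qed simp

text \<open>The common core of the Cauchy-Schwarz inequalities for forms and for finite sums.
  Replace \<open>A\<close> by a scalar \<open>t\<close> above its norm, insert
  \<open>a = B / t\<close>, and compare norms; \<open>e > 0\<close> keeps \<open>t\<close> positive
  and then tends to 0.\<close>

lemma norm_square_le_of_cpos:
  assumes "\<And>a. cpos (star a * A * a - star a * B - star B * a + C)" "cpos A" "cpos C"
  shows "(norm B)\<^sup>2 \<le> norm A * norm C"
proof -
  have *: "(norm B)\<^sup>2 \<le> (norm A + e) * norm C" if "e > 0" for e
  proof -
    define t where "t = norm A + e"
    have t: "t > 0" "norm A \<le> t" using that by (auto simp: t_def add_nonneg_pos)
    define a where "a = (1 / t) *\<^sub>R B"
    have aa: "star a * B = t *\<^sub>R (star a * a)" "star B * a = t *\<^sub>R (star a * a)"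
      using t by (simp_all add: a_def star_scaleR)
    have "cpos ((star a * A * a - star a * B - star B * a + C)
        + (norm A *\<^sub>R (star a * a) - star a * A * a) + (t - norm A) *\<^sub>R (star a * a))"
      using t by (intro cpos_add assms cpos_conj_le cpos_scaleR cpos_star_mult) auto
    also have "(star a * A * a - star a * B - star B * a + C)
        + (norm A *\<^sub>R (star a * a) - star a * A * a) + (t - norm A) *\<^sub>R (star a * a)
        = C - t *\<^sub>R (star a * a)"
      by (simp add: aa scaleR_diff_left)
    finally have "norm (t *\<^sub>R (star a * a)) \<le> norm C"
      using t by (intro cpos_norm_mono cpos_scaleR cpos_star_mult) auto
    moreover have "norm (t *\<^sub>R (star a * a)) = t * (norm a)\<^sup>2" using t by (simp add: norm_star_mult)
    moreover have "\<dots> = (norm B)\<^sup>2 / t" using t by (simp add: a_def power2_eq_square)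
    ultimately show ?thesis using t by (simp add: divide_le_eq t_def mult.commute)
  qed
  have "((\<lambda>e. (norm A + e) * norm C) \<longlongrightarrow> (norm A + 0) * norm C) (at_right 0)"
    by (intro tendsto_intros)
  then have "(norm B)\<^sup>2 \<le> (norm A + 0) * norm C"
    by (rule tendsto_lowerbound)
      (auto intro!: eventually_mono[OF eventually_at_right_less[of "0::real"]] *)
  then show ?thesis by simp
qed

section \<open>Positive operators on Hilbert modules\<close>

context hilbert_module
begin

text \<open>Positivity of the form at \<open>act x a - y\<close> is the quadratic hypothesis of
  \<open>norm_square_le_of_cpos\<close>.\<close>

lemma form_cauchy_schwarz:
  assumes sym: "\<And>x y. ip (T x) y = ip x (T y)" and pos: "\<And>x. cpos (ip x (T x))"
  shows "(norm (ip x (T y)))\<^sup>2 \<le> norm (ip x (T x)) * norm (ip y (T y))"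
proof (rule norm_square_le_of_cpos[OF _ pos pos])
  fix a
  have "ip (act x a - y) (T (act x a - y))
      = ip (T (act x a - y)) (act x a - y)" by (simp add: sym)
  also have "\<dots> = ip (T (act x a - y)) x * a - ip (T (act x a - y)) y"
    by (simp add: ip_diff_right ip_act_right)
  also have "\<dots> = star a * ip x (T x) * a - star a * ip x (T y) - star (ip x (T y)) * a + ip y (T y)"
    by (simp add: sym ip_diff_left ip_act_left ip_star left_diff_distrib)
  finally show "cpos (star a * ip x (T x) * a - star a * ip x (T y) - star (ip x (T y)) * a + ip y (T y))"
    using pos by metis
qed

end

text \<open>The form of the identity map gives Cauchy-Schwarz in every Hilbert module, which opens
  the operator theory to all of them.\<close>

sublocale hilbert_module \<subseteq> hilbert_module_cs
proof
  fix x y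
  have "(norm (ip x y))\<^sup>2 \<le> (norm x * norm y)\<^sup>2"
    using form_cauchy_schwarz[of "\<lambda>x. x" x y] ip_pos by (simp add: power_mult_distrib norm_power2_ip)
  then show "norm (ip x y) \<le> norm x * norm y" by (rule power2_le_imp_le) simp
qed

context hilbert_module
begin

text \<open>Apply the form inequality to the pair \<open>T x\<close>, \<open>x\<close>. Each factor
  on the right is bounded through \<open>T \<le> 1\<close>, and a power of \<open>norm (T x)\<close>
  cancels.\<close>

lemma contraction_of_cpos:
  assumes sym: "\<And>x y. ip (T x) y = ip x (T y)" and pos: "\<And>x. cpos (ip x (T x))"
    and le: "\<And>x. cpos (ip x x - ip x (T x))"
  shows "norm (T x) \<le> norm x"
proof -
  have "norm (T x) ^ 4 = (norm (ip (T x) (T x)))\<^sup>2" by (simp flip: norm_power2_ip)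
  also have "\<dots> \<le> norm (ip (T x) (T (T x))) * norm (ip x (T x))"
    by (rule form_cauchy_schwarz[OF sym pos])
  also have "\<dots> \<le> (norm (T x))\<^sup>2 * (norm x)\<^sup>2"
    unfolding norm_power2_ip by (intro mult_mono cpos_norm_mono pos le) auto
  finally have "(norm (T x))\<^sup>2 * (norm (T x))\<^sup>2 \<le> (norm (T x))\<^sup>2 * (norm x)\<^sup>2"
    by (simp flip: power_add)
  then have "(norm (T x))\<^sup>2 \<le> (norm x)\<^sup>2" if "T x \<noteq> 0"
    by (rule mult_left_le_imp_le) (use that in simp)
  then show ?thesis by (cases "T x = 0") (auto intro: power2_le_imp_le)
qed

text \<open>With \<open>K = norm b\<close>, the operator \<open>K\<^sup>2 - b\<^sup>2\<close> has a
  root \<open>w\<close>, and \<open>w\<^sup>2 + (K - b)\<^sup>2 = 2 K (K - b)\<close>.\<close>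

lemma sa_le_norm:
  assumes "sa b"
  shows "cpos (norm b *\<^sub>R ip x x - ip x (b x))"
proof (cases "b = 0")
  case False
  define K where "K = norm b"
  have K: "K > 0" using False by (simp add: K_def)
  have "norm (b o\<^sub>L b) \<le> K\<^sup>2" unfolding K_def power2_eq_square by (rule norm_blinfun_compose)
  then have "op_pos (K\<^sup>2 *\<^sub>R id_blinfun - (b o\<^sub>L b))"
    unfolding op_pos_def using K assms
    by (auto intro!: exI[of _ "K\<^sup>2"] sa_lin sa_id sa_compose)
  then obtain w where w: "sa w" "\<And>x. w (w x) = (K\<^sup>2 *\<^sub>R id_blinfun - (b o\<^sub>L b)) x"
    using pos_root by metis
  have "ip (w x) (w x) + ip (K *\<^sub>R x - b x) (K *\<^sub>R x - b x)
      = (2 * K) *\<^sub>R (K *\<^sub>R ip x x - ip x (b x))"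
    by (simp add: saD[OF w(1)] saD[OF assms] w(2) blinfun.bilinear_simps ip_bilinear
        power2_eq_square algebra_simps scaleR_2[symmetric])
  then have "cpos ((2 * K) *\<^sub>R (K *\<^sub>R ip x x - ip x (b x)))" by (metis cpos_add ip_pos)
  from cpos_scaleR[OF this, of "1 / (2 * K)"] K show ?thesis by (simp add: K_def)
qed simp

text \<open>Links pointwise positivity to the norm criterion: for \<open>K = norm b + 1\<close> the
  operator \<open>1 - b / K\<close> lies between 0 and 1, hence is a contraction.\<close>

lemma op_pos_of_cpos:
  assumes "sa b" "\<And>x. cpos (ip x (b x))"
  shows "op_pos b"
proof -
  define K where "K = norm b + 1"
  have K: "K > 0" by (simp add: K_def add_nonneg_pos)
  have "norm (x - (1 / K) *\<^sub>R b x) \<le> norm x" for x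
  proof (rule contraction_of_cpos)
    fix x y
    show "ip (x - (1 / K) *\<^sub>R b x) y = ip x (y - (1 / K) *\<^sub>R b y)"
      by (simp add: ip_bilinear saD[OF assms(1)])
    have "cpos ((1 / K) *\<^sub>R ((norm b *\<^sub>R ip x x - ip x (b x)) + ip x x))"
      using K by (intro cpos_scaleR cpos_add sa_le_norm assms ip_pos) auto
    also have "(1 / K) *\<^sub>R ((norm b *\<^sub>R ip x x - ip x (b x)) + ip x x)
        = (1 / K) *\<^sub>R (K *\<^sub>R ip x x - ip x (b x))"
      by (simp add: K_def algebra_simps)
    also have "\<dots> = ip x (x - (1 / K) *\<^sub>R b x)"
      using K by (simp add: ip_bilinear scaleR_diff_right)
    finally show "cpos (ip x (x - (1 / K) *\<^sub>R b x))" .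
    show "cpos (ip x x - ip x (x - (1 / K) *\<^sub>R b x))"
      using K assms(2) by (simp add: ip_bilinear cpos_scaleR)
  qed
  then have "norm ((K *\<^sub>R id_blinfun - b) x) \<le> K * norm x" for x
  proof -
    have "(K *\<^sub>R id_blinfun - b) x = K *\<^sub>R (x - (1 / K) *\<^sub>R b x)"
      using K by (simp add: blinfun.bilinear_simps scaleR_diff_right)
    then show ?thesis using \<open>norm (x - (1 / K) *\<^sub>R b x) \<le> norm x\<close> K by simp
  qed
  then have "norm (K *\<^sub>R id_blinfun - b) \<le> K" using K by (intro norm_blinfun_bound) auto
  with K assms(1) show ?thesis by (auto simp: op_pos_def)
qed

end

section \<open>Adjointable maps from the algebra\<close>

lemma sum_lessThan_add:
  fixes f :: "nat \<Rightarrow> 'b::comm_monoid_add"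
  shows "(\<Sum>i<m + n. f i) = (\<Sum>i<m. f i) + (\<Sum>i<n. f (m + i))"
  by (induction n) (simp_all add: add.assoc)

lemma convergent_of_dist_le:
  fixes X :: "nat \<Rightarrow> 'b::banach"
  assumes "\<delta> \<longlonglongrightarrow> 0" "\<And>m n. norm (X m - X n) \<le> (\<delta> m + \<delta> n) * K"
  shows "convergent X"
proof -
  have "Cauchy X"
  proof (rule CauchyI)
    fix e :: real assume e: "e > 0"
    have "(\<lambda>n. \<delta> n * K) \<longlonglongrightarrow> 0 * K" by (intro tendsto_intros assms)
    then obtain N where N: "\<And>n. n \<ge> N \<Longrightarrow> \<bar>\<delta> n * K\<bar> < e / 2"
      using LIMSEQ_D[of "\<lambda>n. \<delta> n * K" 0 "e / 2"] e by auto
    have "norm (X m - X n) < e" if "m \<ge> N" "n \<ge> N" for m n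
      using assms(2)[of m n] N[OF that(1)] N[OF that(2)] by (simp add: algebra_simps)
    then show "\<exists>M. \<forall>m\<ge>M. \<forall>n\<ge>M. norm (X m - X n) < e" by blast
  qed
  then show ?thesis by (simp add: Cauchy_convergent_iff)
qed

context hilbert_module
begin

section \<open>Linearity and boundedness of adjointable maps and their adjoints\<close>

lemma mult_ip_right: "v \<in> mult_module ip \<Longrightarrow> ip x (v a) = star (madj ip v x) * a"
  by (metis ip_star madj star_mult star_star)

lemma mult_lin:
  assumes "v \<in> mult_module ip"
  shows "v (a + b) = v a + v b" "v (r *\<^sub>R a) = r *\<^sub>R v a" "v (a * b) = act (v a) b"
  by (rule ip_eqI; simp add: mult_ip_right[OF assms] ip_bilinear ip_act_right algebra_simps)+

lemma madj_lin:
  assumes "v \<in> mult_module ip"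
  shows "madj ip v (x + y) = madj ip v x + madj ip v y" "madj ip v (x - y) = madj ip v x - madj ip v y"
    "madj ip v (r *\<^sub>R x) = r *\<^sub>R madj ip v x" "madj ip v (c *\<^sub>C x) = c *\<^sub>C madj ip v x"
  by (rule alg_ip_eqI; simp add: madj[OF assms, symmetric] ip_bilinear ip_scaleC_right algebra_simps
      mult_scaleC_right)+

lemma mult_module_scaleC:
  assumes "v \<in> mult_module ip"
  shows "(\<lambda>a. c *\<^sub>C v a) \<in> mult_module ip"
  unfolding mult_module_def[of ip] adjointable_def is_adjoint_def
  by (auto simp: alg_ip_def ip_scaleC_left mult_scaleC_right
      intro!: exI[of _ "\<lambda>x. cnj c *\<^sub>C madj ip v x"] madj[OF assms])

text \<open>The sets \<open>norm (v a) \<le> n\<close> are closed because the norm of \<open>v a\<close> is the supremum of the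
  norms of \<open>a \<mapsto> ip (v a) x\<close>; by Baire, one of them contains a ball.\<close>

lemma mult_bounded_linear:
  assumes v: "v \<in> mult_module ip"
  shows "bounded_linear v"
proof -
  define F where "F n = {a. \<forall>x. norm (star a * madj ip v x) \<le> real n * norm x}" for n
  have F: "a \<in> F n \<longleftrightarrow> norm (v a) \<le> real n" for a n
  proof
    assume "a \<in> F n"
    then have "(norm (v a))\<^sup>2 \<le> real n * norm (v a)"
      by (simp add: F_def norm_power2_ip madj[OF v])
    then show "norm (v a) \<le> real n" by (cases "v a = 0") (auto simp: power2_eq_square)
  next
    assume "norm (v a) \<le> real n"
    then have "norm (ip (v a) x) \<le> real n * norm x" for x
      by (intro order_trans[OF cauchy_schwarz] mult_right_mono) auto
    then show "a \<in> F n" by (simp add: F_def madj[OF v])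
  qed
  have closed: "closed (F n)" for n
    unfolding F_def Collect_all_eq
    by (intro closed_INT closed_Collect_le continuous_intros ballI
        bounded_linear.continuous_on[OF bounded_linear_star])
  have "\<exists>n. interior (F n) \<noteq> {}"
  proof (rule ccontr)
    assume "\<not> ?thesis"
    then have "euclidean interior_of \<Union> (range F) = {}"
      by (intro Baire_category_alt) (auto simp: closed completely_metrizable_space_euclidean)
    moreover have "\<Union> (range F) = UNIV"
    proof -
      have "\<exists>n. a \<in> F n" for a using F[of a] real_arch_simple[of "norm (v a)"] by auto
      then show ?thesis by blast
    qed
    ultimately show False by simp
  qed
  then obtain n a e where e: "e > 0" "ball a e \<subseteq> F n"
    by (metis all_not_in_conv mem_interior)
  have b: "norm (v b) \<le> norm b * (4 * real n / e)" for b
  proof (cases "b = 0")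
    case True
    then show ?thesis using mult_lin(2)[OF v, of 0 b] by simp
  next
    case False
    \<comment> \<open>This scales \<open>b\<close> to length \<open>e / 2\<close>, which keeps the
      translate of \<open>a\<close> inside the ball.\<close>
    define t where "t = e / (2 * norm b)"
    have t: "t > 0" using False e by (simp add: t_def)
    have "norm (v a) \<le> n" "norm (v (a + t *\<^sub>R b)) \<le> n"
      using e False by (auto simp: F[symmetric] subset_iff dist_norm t_def)
    moreover have "t *\<^sub>R v b = v (a + t *\<^sub>R b) - v a" by (simp add: mult_lin[OF v])
    ultimately have "norm (t *\<^sub>R v b) \<le> n + n"
      using norm_triangle_ineq4[of "v (a + t *\<^sub>R b)" "v a"] by simp
    then show ?thesis using t False e by (simp add: t_def field_simps)
  qed
  show ?thesis by (rule bounded_linear_intro[OF _ _ b])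
      (simp_all add: mult_lin[OF v])
qed

lemma madj_bounded_linear:
  assumes v: "v \<in> mult_module ip"
  shows "bounded_linear (madj ip v)"
proof -
  obtain K where K: "K \<ge> 0" "\<And>a. norm (v a) \<le> norm a * K"
    using bounded_linear.nonneg_bounded[OF mult_bounded_linear[OF v]] by blast
  have "norm (madj ip v x) \<le> norm x * K" for x
  proof -
    let ?a = "madj ip v x"
    have "(norm ?a)\<^sup>2 = norm (ip (v ?a) x)" by (simp add: madj[OF v] norm_star_mult)
    also have "\<dots> \<le> (norm ?a * K) * norm x"
      by (intro order_trans[OF cauchy_schwarz] mult_right_mono K) auto
    finally show ?thesis by (cases "?a = 0") (auto simp: power2_eq_square K(1) mult_ac)
  qed
  then show ?thesis by (intro bounded_linear_intro) (simp_all add: madj_lin[OF v])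
qed

section \<open>Positive operators of finite rank\<close>

lemma ip_theta_sum:
  assumes "\<And>i. i < N \<Longrightarrow> w i \<in> mult_module ip"
  shows "ip x (\<Sum>i<N. w i (madj ip (z i) y)) = (\<Sum>i<N. star (madj ip (w i) x) * madj ip (z i) y)"
  using assms by (simp add: ip_sum_right mult_ip_right)

text \<open>A positive operator \<open>T\<close> dominated by \<open>b = (\<Sum>i<N. g i (g i)\<^sup>*)\<close> is itself such a sum: with
  \<open>r = sqrt T\<close>, \<open>s = sqrt b\<close> and \<open>b C n \<longlonglongrightarrow> s\<close>, the maps \<open>r C n (g i)\<close> converge.\<close>

lemma pos_dominated_factor:
  fixes T b :: "'x \<Rightarrow>\<^sub>L 'x"
  assumes g: "\<And>i. i < N \<Longrightarrow> g i \<in> mult_module ip"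
    and b: "op_pos b" "\<And>x. b x = (\<Sum>i<N. g i (madj ip (g i) x))"
    and T: "op_pos T" "\<And>x. cpos (ip x (T x))" "\<And>x. cpos (ip x (b x) - ip x (T x))"
  obtains f where "\<And>i. i < N \<Longrightarrow> f i \<in> mult_module ip"
    "\<And>x. ip x (T x) = (\<Sum>i<N. frame_term ip f x i)"
proof (rule pos_root[OF b(1)])
  fix s C
  assume s: "sa s" "\<And>x. s (s x) = b x"
    "\<And>(S :: 'x \<Rightarrow>\<^sub>L 'x) x. (\<And>x. S (b x) = b (S x)) \<Longrightarrow> S (s x) = s (S x)"
    and C: "\<And>n. sa (C n)" "(\<lambda>n. b o\<^sub>L C n) \<longlonglongrightarrow> s"
    "\<And>(S :: 'x \<Rightarrow>\<^sub>L 'x) n x. (\<And>x. S (b x) = b (S x)) \<Longrightarrow> S (C n x) = C n (S x)"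
  obtain r where r: "sa r" "\<And>x. r (r x) = T x" using pos_root[OF T(1)] by metis
  have bC: "b (C n x) = C n (b x)" and sC: "s (C n x) = C n (s x)" for n x
    using C(3)[of b n x] s(3)[of "C n" x] C(3)[of s n x] by (simp_all flip: s(2))
  define \<delta> where "\<delta> n = norm (s - (b o\<^sub>L C n))" for n
  have "\<delta> \<longlonglongrightarrow> norm (s - s)" unfolding \<delta>_def by (intro tendsto_intros C(2))
  then have \<delta>: "\<delta> \<longlonglongrightarrow> 0" by simp
  have norm_b: "norm (ip x (b x)) = (norm (s x))\<^sup>2" for x
    by (simp add: norm_power2_ip saD[OF s(1)] s(2))
  \<comment> \<open>The domination of \<open>T\<close> by \<open>b\<close> bounds
    \<open>r ?y\<close> by \<open>s ?y\<close>, and \<open>s (1 - s C n) = s - b C n\<close> has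
    norm \<open>\<delta> n\<close>.\<close>
  have re: "norm (r (x - s (C n x))) \<le> \<delta> n * norm x" for n x
  proof -
    let ?y = "x - s (C n x)"
    have "(norm (r ?y))\<^sup>2 = norm (ip ?y (T ?y))" by (simp add: norm_power2_ip saD[OF r(1)] r(2))
    also have "\<dots> \<le> (norm (s ?y))\<^sup>2" unfolding norm_b[symmetric] by (intro cpos_norm_mono T)
    also have "s ?y = (s - (b o\<^sub>L C n)) x" by (simp add: blinfun.bilinear_simps s(2))
    also have "(norm \<dots>)\<^sup>2 \<le> (\<delta> n * norm x)\<^sup>2" unfolding \<delta>_def by (intro power_mono norm_blinfun) auto
    finally show ?thesis by (rule power2_le_imp_le) (simp add: \<delta>_def)
  qed
  \<comment> \<open>\<open>r - s C n r\<close> is the adjoint of the operator in \<open>re\<close>,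
    so it obeys the same bound.\<close>
  have er: "norm (r x - s (C n (r x))) \<le> \<delta> n * norm x" for n x
  proof -
    let ?y = "r x - s (C n (r x))"
    have "(norm ?y)\<^sup>2 = norm (ip (r (?y - s (C n ?y))) x)"
      unfolding norm_power2_ip
      by (simp add: blinfun.bilinear_simps ip_bilinear saD[OF r(1)] saD[OF s(1)] saD[OF C(1)] sC)
    also have "\<dots> \<le> (\<delta> n * norm ?y) * norm x"
      by (intro order_trans[OF cauchy_schwarz] mult_right_mono re) auto
    finally show ?thesis
      by (cases "?y = 0") (auto simp: power2_eq_square \<delta>_def mult_ac)
  qed
  have sr: "(\<lambda>n. s (C n (r x))) \<longlonglongrightarrow> r x" for x
  proof -
    have "(\<lambda>n. \<delta> n * norm x) \<longlonglongrightarrow> 0" by (intro tendsto_mult_left_zero \<delta>)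
    then have "(\<lambda>n. r x - s (C n (r x))) \<longlonglongrightarrow> 0"
      by (rule Lim_null_comparison[rotated]) (auto simp: er)
    from tendsto_diff[OF tendsto_const[of "r x"] this] show ?thesis by simp
  qed
  \<comment> \<open>\<open>h i n\<close> is the adjoint of \<open>q i n\<close>; convergence of both
    makes the limit adjointable.\<close>
  define h where "h i n x = madj ip (g i) (C n (r x))" for i n x
  define q where "q i n c = r (C n (g i c))" for i n c
  have hq: "ip (q i n c) x = star c * h i n x" if "i < N" for i n c x
    unfolding q_def h_def by (simp add: saD[OF r(1)] saD[OF C(1)] madj[OF g[OF that]])
  have ipb: "ip y (b y) = (\<Sum>i<N. star (madj ip (g i) y) * madj ip (g i) y)" for y
    unfolding b(2) by (rule ip_theta_sum[OF g])
  \<comment> \<open>A single term of the sum \<open>ip y (b y)\<close> is dominated by the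
    whole.\<close>
  have h_norm: "norm (madj ip (g i) y) \<le> norm (s y)" if "i < N" for i y
  proof -
    have "ip y (b y) = star (madj ip (g i) y) * madj ip (g i) y
        + (\<Sum>i\<in>{..<N} - {i}. star (madj ip (g i) y) * madj ip (g i) y)"
      unfolding ipb using that by (intro sum.remove) auto
    then have "norm (star (madj ip (g i) y) * madj ip (g i) y) \<le> norm (ip y (b y))"
      by (intro cpos_norm_mono cpos_star_mult) (auto intro!: cpos_sum cpos_star_mult)
    then have "(norm (madj ip (g i) y))\<^sup>2 \<le> (norm (s y))\<^sup>2" by (simp add: norm_star_mult norm_b)
    then show ?thesis by (rule power2_le_imp_le) simp
  qed
  have h_diff: "norm (h i m x - h i n x) \<le> (\<delta> m + \<delta> n) * norm x" if "i < N" for i m n x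
  proof -
    have "norm (h i m x - h i n x) \<le> norm (s (C m (r x) - C n (r x)))"
      unfolding h_def madj_lin(2)[OF g[OF that], symmetric] by (rule h_norm[OF that])
    also have "s (C m (r x) - C n (r x)) = (r x - s (C n (r x))) - (r x - s (C m (r x)))"
      by (simp add: blinfun.bilinear_simps)
    also have "norm \<dots> \<le> \<delta> n * norm x + \<delta> m * norm x"
      by (rule norm_triangle_le_diff) (intro add_mono er)
    finally show ?thesis by (simp add: algebra_simps)
  qed
  have q_diff: "norm (q i m c - q i n c) \<le> (\<delta> m + \<delta> n) * norm c" if "i < N" for i m n c
  proof -
    let ?z = "q i m c - q i n c"
    have "(norm ?z)\<^sup>2 = norm (star c * (h i m ?z - h i n ?z))"
      unfolding norm_power2_ip by (subst (1) ip_diff_left) (simp add: hq[OF that] algebra_simps)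
    also have "\<dots> \<le> norm c * ((\<delta> m + \<delta> n) * norm ?z)"
      by (rule order_trans[OF norm_mult_ineq]) (simp add: mult_left_mono h_diff[OF that])
    finally show ?thesis
      by (cases "?z = 0") (auto simp: power2_eq_square \<delta>_def mult_ac)
  qed
  define f where "f i c = lim (\<lambda>n. q i n c)" for i c
  define F where "F i x = lim (\<lambda>n. h i n x)" for i x
  have f: "(\<lambda>n. q i n c) \<longlonglongrightarrow> f i c" if "i < N" for i c
    unfolding f_def convergent_LIMSEQ_iff[symmetric] using convergent_of_dist_le[OF \<delta> q_diff[OF that]] .
  have F: "(\<lambda>n. h i n x) \<longlonglongrightarrow> F i x" if "i < N" for i x
    unfolding F_def convergent_LIMSEQ_iff[symmetric] using convergent_of_dist_le[OF \<delta> h_diff[OF that]] .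
  have fF: "ip (f i c) x = star c * F i x" if "i < N" for i c x
  proof (rule LIMSEQ_unique)
    show "(\<lambda>n. ip (q i n c) x) \<longlonglongrightarrow> ip (f i c) x" by (intro tendsto_ip tendsto_const f that)
    show "(\<lambda>n. ip (q i n c) x) \<longlonglongrightarrow> star c * F i x"
      unfolding hq[OF that] by (intro tendsto_intros F that)
  qed
  show thesis
  proof
    show "f i \<in> mult_module ip" if "i < N" for i
      unfolding mult_module_def adjointable_def is_adjoint_def alg_ip_def using fF[OF that] by auto
    have madj_f: "madj ip (f i) = F i" if "i < N" for i by (rule madj_eqI) (rule fF[OF that])
    show "ip x (T x) = (\<Sum>i<N. frame_term ip f x i)" for x
    proof (rule LIMSEQ_unique)
      \<comment> \<open>The form of \<open>b\<close> at \<open>C n (r x)\<close> is computed twice: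
        through \<open>b = s\<^sup>2\<close> it tends to the form of \<open>T\<close>, and as a sum
        of squares of \<open>h i n x\<close> it tends to the frame terms of
        \<open>f\<close>.\<close>
      have "(\<lambda>n. ip (s (C n (r x))) (s (C n (r x)))) \<longlonglongrightarrow> ip (r x) (r x)"
        by (intro tendsto_ip sr)
      then show "(\<lambda>n. ip (C n (r x)) (b (C n (r x)))) \<longlonglongrightarrow> ip x (T x)"
        by (simp add: saD[OF s(1)] saD[OF r(1)] s(2) r(2))
      have "(\<lambda>n. \<Sum>i<N. star (h i n x) * h i n x) \<longlonglongrightarrow> (\<Sum>i<N. star (F i x) * F i x)"
        by (intro tendsto_intros tendsto_star F) auto
      then show "(\<lambda>n. ip (C n (r x)) (b (C n (r x)))) \<longlonglongrightarrow> (\<Sum>i<N. frame_term ip f x i)"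
        by (simp add: ipb h_def frame_term_def mult_pair_def madj_f)
    qed
  qed
qed

lemma pos_finite_rank_factor:
  fixes T :: "'x \<Rightarrow>\<^sub>L 'x" and N :: nat
  assumes wz: "\<And>i. i < N \<Longrightarrow> w i \<in> mult_module ip" "\<And>i. i < N \<Longrightarrow> z i \<in> mult_module ip"
    and T: "sa T" "\<And>x. cpos (ip x (T x))" "\<And>x. T x = (\<Sum>i<N. w i (madj ip (z i) x))"
  shows "\<exists>M f. (\<forall>i<M. f i \<in> mult_module ip) \<and> (\<forall>x. ip x (T x) = (\<Sum>i<M. frame_term ip f x i))"
proof -
  define g where "g i = (if i < N then w i else z (i - N))" for i :: nat
  have g: "g i \<in> mult_module ip" if "i < N + N" for i
    using that wz by (auto simp: g_def)
  have "bounded_linear (\<lambda>x. \<Sum>i<N + N. g i (madj ip (g i) x))"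
    by (intro bounded_linear_sum bounded_linear_compose[OF mult_bounded_linear madj_bounded_linear] g) auto
  then obtain b where b: "\<And>x. blinfun_apply b x = (\<Sum>i<N + N. g i (madj ip (g i) x))"
    using that[of "Blinfun (\<lambda>x. \<Sum>i<N + N. g i (madj ip (g i) x))"]
    by (simp only: bounded_linear_Blinfun_apply)
  have ipb: "ip x (b y) = (\<Sum>i<N + N. star (madj ip (g i) x) * madj ip (g i) y)" for x y
    unfolding b by (rule ip_theta_sum[OF g])
  have sab: "sa b" unfolding sa_def
  proof (intro allI)
    fix x y
    have "ip (b x) y = star (ip y (b x))" by (simp add: ip_star)
    then show "ip (b x) y = ip x (b y)" by (simp add: ipb star_sum star_mult star_star)
  qed
  have posb: "op_pos b"
    by (rule op_pos_of_cpos[OF sab]) (auto simp: ipb intro!: cpos_sum cpos_star_mult)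
  have "cpos (ip x (b x) - ip x (T x))" for x
  proof -
    define \<alpha> \<beta> where "\<alpha> i = madj ip (w i) x" and "\<beta> i = madj ip (z i) x" for i
    have bx: "ip x (b x) = (\<Sum>i<N. star (\<alpha> i) * \<alpha> i + star (\<beta> i) * \<beta> i)"
      by (simp add: ipb sum_lessThan_add g_def \<alpha>_def \<beta>_def sum.distrib)
    have Tx: "ip x (T x) = (\<Sum>i<N. star (\<alpha> i) * \<beta> i)"
      unfolding T(3) \<alpha>_def \<beta>_def by (rule ip_theta_sum[OF wz(1)])
    moreover have "star (ip x (T x)) = ip x (T x)" by (simp add: ip_star saD[OF T(1)])
    ultimately have Tx': "ip x (T x) = (\<Sum>i<N. star (\<beta> i) * \<alpha> i)"
      by (simp add: star_sum star_mult star_star)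
    \<comment> \<open>As \<open>T\<close> is self-adjoint, \<open>b - 2 T\<close> is the sum of the
      squares of \<open>\<alpha> i - \<beta> i\<close>, and \<open>b - T\<close> is half of
      \<open>b + (b - 2 T)\<close>.\<close>
    have "cpos ((1/2) *\<^sub>R ((\<Sum>i<N. star (\<alpha> i) * \<alpha> i + star (\<beta> i) * \<beta> i)
        + (\<Sum>i<N. star (\<alpha> i - \<beta> i) * (\<alpha> i - \<beta> i))))"
      by (intro cpos_scaleR cpos_add cpos_sum cpos_star_mult) auto
    also have "(\<Sum>i<N. star (\<alpha> i - \<beta> i) * (\<alpha> i - \<beta> i)) = ip x (b x) - ip x (T x) - ip x (T x)"
      unfolding bx by (subst Tx, subst Tx')
        (simp add: star_diff algebra_simps flip: sum.distrib sum_subtractf)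
    also have "(1/2) *\<^sub>R ((\<Sum>i<N. star (\<alpha> i) * \<alpha> i + star (\<beta> i) * \<beta> i) + (ip x (b x) - ip x (T x) - ip x (T x)))
        = (1/2) *\<^sub>R (2 *\<^sub>R (ip x (b x) - ip x (T x)))"
      by (rule arg_cong[where f = "(*\<^sub>R) (1/2)"]) (simp add: scaleR_2 algebra_simps flip: bx)
    finally show ?thesis by simp
  qed
  from pos_dominated_factor[OF g posb b op_pos_of_cpos[OF T(1,2)] T(2) this] show ?thesis
    by metis
qed

end

section \<open>The frame operator of a Bessel sequence\<close>

lemma sum_cauchy_schwarz:
  fixes \<alpha> s :: "'i \<Rightarrow> 'a::cstar_algebra"
  shows "(norm (\<Sum>n\<in>F. star (\<alpha> n) * s n))\<^sup>2
    \<le> norm (\<Sum>n\<in>F. star (\<alpha> n) * \<alpha> n) * norm (\<Sum>n\<in>F. star (s n) * s n)"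
proof (rule norm_square_le_of_cpos)
  fix a :: 'a
  have "cpos (\<Sum>n\<in>F. star (\<alpha> n * a - s n) * (\<alpha> n * a - s n))"
    by (intro cpos_sum cpos_star_mult)
  also have "(\<Sum>n\<in>F. star (\<alpha> n * a - s n) * (\<alpha> n * a - s n))
      = star a * (\<Sum>n\<in>F. star (\<alpha> n) * \<alpha> n) * a - star a * (\<Sum>n\<in>F. star (\<alpha> n) * s n)
        - star (\<Sum>n\<in>F. star (\<alpha> n) * s n) * a + (\<Sum>n\<in>F. star (s n) * s n)"
    by (simp add: star_sum star_diff star_mult star_star sum_distrib_left sum_distrib_right
        sum.distrib sum_subtractf algebra_simps)
  finally show "cpos (star a * (\<Sum>n\<in>F. star (\<alpha> n) * \<alpha> n) * a - star a * (\<Sum>n\<in>F. star (\<alpha> n) * s n)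
        - star (\<Sum>n\<in>F. star (\<alpha> n) * s n) * a + (\<Sum>n\<in>F. star (s n) * s n))" .
qed (intro cpos_sum cpos_star_mult)+

lemma cpos_suminf_minus_sum:
  assumes "summable f" "\<And>n. cpos (f n)" "finite F"
  shows "cpos ((\<Sum>n. f n) - sum f F)"
proof -
  obtain M where M: "F \<subseteq> {..<M}"
    using assms(3) finite_nat_iff_bounded by blast
  have "(\<lambda>n. sum f {..<n + M} - sum f F) \<longlonglongrightarrow> (\<Sum>n. f n) - sum f F"
    by (intro tendsto_intros LIMSEQ_ignore_initial_segment summable_LIMSEQ assms)
  moreover have "cpos (sum f {..<n + M} - sum f F)" for n
  proof -
    have "sum f {..<n + M} - sum f F = sum f ({..<n + M} - F)"
      using M by (subst sum_diff) auto
    then show ?thesis using assms(2) by (simp add: cpos_sum)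
  qed
  ultimately show ?thesis by (rule cpos_limit)
qed

context hilbert_module
begin

lemma frame_term_eq: "frame_term ip v x n = star (madj ip (v n) x) * madj ip (v n) x"
  by (simp add: frame_term_def mult_pair_def)

text \<open>Duality: pair the finite sum \<open>?z\<close> with itself, apply
  \<open>sum_cauchy_schwarz\<close> and the Bessel inequality at \<open>?z\<close>, then cancel its
  squared norm.\<close>

lemma synthesis_bound:
  assumes "\<And>n. v n \<in> mult_module ip" "bessel_bound ip v B" "finite F"
  shows "(norm (\<Sum>n\<in>F. v n (s n)))\<^sup>2 \<le> B * norm (\<Sum>n\<in>F. star (s n) * s n)"
proof -
  have B: "B > 0" "summable (frame_term ip v x)" "cpos (B *\<^sub>R ip x x - (\<Sum>n. frame_term ip v x n))" for x
    using assms(2) by (auto simp: bessel_bound_def cle_def)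
  let ?z = "\<Sum>n\<in>F. v n (s n)"
  have "cpos ((\<Sum>n. frame_term ip v ?z n) - (\<Sum>n\<in>F. frame_term ip v ?z n))"
    by (intro cpos_suminf_minus_sum B assms(3)) (simp add: frame_term_eq cpos_star_mult)
  from cpos_add[OF B(3)[of ?z] this]
  have "cpos (B *\<^sub>R ip ?z ?z - (\<Sum>n\<in>F. frame_term ip v ?z n))" by simp
  then have "norm (\<Sum>n\<in>F. frame_term ip v ?z n) \<le> norm (B *\<^sub>R ip ?z ?z)"
    by (intro cpos_norm_mono cpos_sum) (auto simp: frame_term_eq cpos_star_mult)
  then have *: "norm (\<Sum>n\<in>F. frame_term ip v ?z n) \<le> B * (norm ?z)\<^sup>2"
    using B(1) by (simp add: norm_power2_ip)
  have "ip ?z ?z = (\<Sum>n\<in>F. star (madj ip (v n) ?z) * s n)"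
    by (simp only: ip_sum_right mult_ip_right[OF assms(1)])
  then have "(norm ?z)\<^sup>2 * (norm ?z)\<^sup>2 = (norm (\<Sum>n\<in>F. star (madj ip (v n) ?z) * s n))\<^sup>2"
    by (metis norm_power2_ip power2_eq_square)
  also have "\<dots> \<le> norm (\<Sum>n\<in>F. frame_term ip v ?z n) * norm (\<Sum>n\<in>F. star (s n) * s n)"
    unfolding frame_term_eq by (rule sum_cauchy_schwarz)
  also have "\<dots> \<le> (B * (norm ?z)\<^sup>2) * norm (\<Sum>n\<in>F. star (s n) * s n)"
    by (intro mult_right_mono *) auto
  finally have "(norm ?z)\<^sup>2 * (norm ?z)\<^sup>2 \<le> (norm ?z)\<^sup>2 * (B * norm (\<Sum>n\<in>F. star (s n) * s n))"
    by (simp only: mult_ac)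
  then have "(norm ?z)\<^sup>2 \<le> B * norm (\<Sum>n\<in>F. star (s n) * s n)" if "?z \<noteq> 0"
    by (rule mult_left_le_imp_le) (use that in simp)
  then show ?thesis using B(1) by (cases "?z = 0") auto
qed

text \<open>\<open>synthesis_op\<close> is a choice, so an adjoint must first be exhibited. It sends
  \<open>s\<close> to the series of \<open>v n (s n)\<close>, which converges by
  \<open>synthesis_bound\<close>.\<close>

lemma frame_operator_sums:
  assumes v: "\<And>n. v n \<in> mult_module ip" and B: "bessel_bound ip v B"
  shows "(\<lambda>n. star (madj ip (v n) x) * madj ip (v n) y) sums
    ip x (synthesis_op ip v (analysis_op ip v y))"
proof -
  have B0: "B > 0" using B by (simp add: bessel_bound_def)
  have U: "analysis_op ip v x \<in> ell2" for x
    using B by (simp add: bessel_bound_def ell2_def analysis_op_def frame_term_def[abs_def])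
  have S: "summable (\<lambda>n. v n (s n))" if s: "s \<in> ell2" for s
    unfolding summable_Cauchy
  proof (intro allI impI)
    fix e :: real assume e: "e > 0"
    have e': "e\<^sup>2 / B > 0" using e B0 by simp
    have "\<forall>e>0. \<exists>N. \<forall>m\<ge>N. \<forall>n. norm (\<Sum>n=m..<n. star (s n) * s n) < e"
      using s by (simp only: ell2_def summable_Cauchy mem_Collect_eq)
    then obtain N where N: "\<forall>m\<ge>N. \<forall>n. norm (\<Sum>n=m..<n. star (s n) * s n) < e\<^sup>2 / B"
      using e' by (elim allE[of _ "e\<^sup>2 / B"] impE exE)
    have "norm (\<Sum>n=m..<n. v n (s n)) < e" if "m \<ge> N" for m n
    proof -
      have "(norm (\<Sum>n=m..<n. v n (s n)))\<^sup>2 \<le> B * norm (\<Sum>n=m..<n. star (s n) * s n)"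
        by (rule synthesis_bound[OF v B]) simp
      also have "\<dots> < e\<^sup>2" using N that B0 by (simp add: field_simps)
      finally show ?thesis by (rule power2_less_imp_less) (use e in simp)
    qed
    then show "\<exists>N. \<forall>m\<ge>N. \<forall>n. norm (\<Sum>n=m..<n. v n (s n)) < e" by blast
  qed
  have sums: "(\<lambda>n. star (madj ip (v n) x) * s n) sums ip x (\<Sum>n. v n (s n))" if "s \<in> ell2" for s x
    using bounded_linear.sums[OF bounded_bilinear.bounded_linear_right[OF bounded_bilinear_ip]
        summable_sums[OF S[OF that]], of x]
    by (simp add: mult_ip_right[OF v])
  have "is_adjoint UNIV ip ell2 ell2_ip (analysis_op ip v) (\<lambda>s. \<Sum>n. v n (s n))"
    unfolding is_adjoint_def ell2_ip_def
    using U sums by (auto simp: analysis_op_def mult_pair_def sums_iff)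
  then have "is_adjoint UNIV ip ell2 ell2_ip (analysis_op ip v) (synthesis_op ip v)"
    unfolding synthesis_op_def Defs.adjoint_def
    by (rule someI[where P = "is_adjoint UNIV ip ell2 ell2_ip (analysis_op ip v)"])
  then have "ell2_ip (analysis_op ip v x) (analysis_op ip v y) = ip x (synthesis_op ip v (analysis_op ip v y))"
    using U by (simp add: is_adjoint_def)
  moreover have "summable (\<lambda>n. star (madj ip (v n) x) * madj ip (v n) y)"
    using sums[OF U[of y], of x] by (simp add: analysis_op_def mult_pair_def sums_iff)
  ultimately show ?thesis
    by (simp add: sums_iff ell2_ip_def analysis_op_def mult_pair_def)
qed

section \<open>The embedding into the multiplier module and finite rank operators on it\<close>

lemma embed_inject: "mult_embed act x = mult_embed act y \<longleftrightarrow> x = y"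
proof
  assume eq: "mult_embed act x = mult_embed act y"
  let ?u = "x - y"
  have "act x a = act y a" for a using fun_cong[OF eq, of a] by (simp add: mult_embed_def)
  then have "act ?u a = 0" for a
    using act_add_left[of ?u y a] by simp
  \<comment> \<open>The scalar to act with is \<open>ip ?u ?u\<close> itself.\<close>
  then have "ip ?u ?u * ip ?u ?u = 0" by (simp flip: ip_act_right)
  then have "ip ?u ?u = 0" using star_mult_eq_0[of "ip ?u ?u"] by (simp add: ip_star)
  then have "?u = 0" by (rule ip_definite)
  then show "x = y" by simp
qed simp

lemma rank_one_embed:
  assumes "w \<in> mult_module ip" "z \<in> mult_module ip"
  shows "rank_one mult_act (mult_ip ip) w z (mult_embed act x) = mult_embed act (w (madj ip z x))"
  unfolding rank_one_def mult_act_def mult_ip_embed[OF assms(2)]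
  by (simp add: fun_eq_iff mult_embed_def mult_pair_def mult_lin[OF assms(1)])

lemma embed_add: "mult_embed act (x + y) = mult_embed act x + mult_embed act y"
  by (simp add: mult_embed_def fun_eq_iff act_add_left)

lemma embed_0: "mult_embed act 0 = 0"
  using embed_add[of 0 0] by simp

text \<open>Induction over the span; the scalar of each new term is absorbed into
  \<open>w\<close>.\<close>

lemma finite_rank_embed:
  assumes "\<theta> \<in> finite_rank (mult_module ip) mult_act (mult_ip ip)"
  shows "\<exists>N w z. (\<forall>i<N. w i \<in> mult_module ip \<and> z i \<in> mult_module ip) \<and>
    (\<forall>x. \<theta> (mult_embed act x) = mult_embed act (\<Sum>i<(N::nat). w i (madj ip (z i) x)))"
  using assms unfolding finite_rank_def
proof (induction rule: complex_vector.span_induct_alt)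
  case base
  show ?case by (rule exI[of _ 0]) (simp add: embed_0)
next
  case (step c \<rho> \<theta>)
  then obtain w0 z0 where \<rho>: "\<rho> = rank_one mult_act (mult_ip ip) w0 z0"
    "w0 \<in> mult_module ip" "z0 \<in> mult_module ip" by blast
  from step obtain N :: nat and w z where wz: "\<forall>i<N. w i \<in> mult_module ip \<and> z i \<in> mult_module ip"
    "\<And>x. \<theta> (mult_embed act x) = mult_embed act (\<Sum>i<N. w i (madj ip (z i) x))" by blast
  define w' where "w' = w(N := \<lambda>a. c *\<^sub>C w0 a)"
  define z' where "z' = z(N := z0)"
  have "\<forall>i<Suc N. w' i \<in> mult_module ip \<and> z' i \<in> mult_module ip"
    using wz(1) \<rho> by (auto simp: w'_def z'_def mult_module_scaleC)
  moreover have "(c *\<^sub>C \<rho> + \<theta>) (mult_embed act x) = mult_embed act (\<Sum>i<Suc N. w' i (madj ip (z' i) x))" for x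
  proof -
    have "(\<Sum>i<N. w' i (madj ip (z' i) x)) = (\<Sum>i<N. w i (madj ip (z i) x))"
      by (rule sum.cong) (auto simp: w'_def z'_def)
    moreover have "c *\<^sub>C mult_embed act y = mult_embed act (c *\<^sub>C y)" for y
      by (simp add: mult_embed_def fun_eq_iff scaleC_fun_def act_scaleC_left)
    ultimately show ?thesis
      by (simp add: scaleC_fun_def[of c "rank_one mult_act (mult_ip ip) w0 z0"] \<rho>(1) rank_one_embed[OF \<rho>(2,3)] wz(2) embed_add w'_def z'_def
          add.commute)
  qed
  ultimately show ?case by blast
qed

lemma optimal_bessel_bound_le:
  assumes "bessel_bound ip v B"
  shows "optimal_bessel_bound ip v \<le> B"
  unfolding optimal_bessel_bound_def using assms
  by (intro cInf_lower bdd_belowI[of _ 0]) (auto simp: bessel_bound_def)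

text \<open>Instead of asking whether the infimum is attained, the proof takes Bessel bounds below
  \<open>1 + inverse (real (Suc k))\<close> and uses that the positive cone is closed.\<close>

lemma optimal_bessel_bound_le_oneD:
  assumes B: "bessel_bound ip v B" and "optimal_bessel_bound ip v \<le> 1"
  shows "cpos (ip x x - (\<Sum>n. frame_term ip v x n))"
proof (rule cpos_limit)
  show "(\<lambda>k. (1 + inverse (real (Suc k))) *\<^sub>R ip x x - (\<Sum>n. frame_term ip v x n))
      \<longlonglongrightarrow> ip x x - (\<Sum>n. frame_term ip v x n)"
  proof -
    have "(\<lambda>k. (1 + inverse (real (Suc k))) *\<^sub>R ip x x - (\<Sum>n. frame_term ip v x n))
        \<longlonglongrightarrow> (1 + 0) *\<^sub>R ip x x - (\<Sum>n. frame_term ip v x n)"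
      by (intro tendsto_intros LIMSEQ_inverse_real_of_nat)
    then show ?thesis by simp
  qed
  fix k
  have "Inf {B. bessel_bound ip v B} < 1 + inverse (real (Suc k))"
    using assms(2) by (simp add: optimal_bessel_bound_def add_strict_increasing2 order_le_less_trans)
  then obtain C where C: "bessel_bound ip v C" "C < 1 + inverse (real (Suc k))"
    using B cInf_lessD by (metis empty_Collect_eq mem_Collect_eq)
  have "cpos ((C *\<^sub>R ip x x - (\<Sum>n. frame_term ip v x n))
      + ((1 + inverse (real (Suc k))) - C) *\<^sub>R ip x x)"
    using C by (intro cpos_add cpos_scaleR ip_pos) (auto simp: bessel_bound_def cle_def)
  then show "cpos ((1 + inverse (real (Suc k))) *\<^sub>R ip x x - (\<Sum>n. frame_term ip v x n))"
    by (simp add: scaleR_diff_left)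
qed

text \<open>Expanding at \<open>x + y\<close> shows that \<open>ip x (Q y)\<close> and
  \<open>ip y (Q x)\<close> are opposite; replacing \<open>y\<close> by its multiple by the
  imaginary unit shows that they are equal.\<close>

lemma polarization:
  assumes "\<And>x. ip x (Q x) = 0" "\<And>x y. Q (x + y) = Q x + Q y" "\<And>c x. Q (c *\<^sub>C x) = c *\<^sub>C Q x"
  shows "Q y = 0"
proof (rule ip_eqI)
  fix x
  have 1: "ip x (Q y) + ip y (Q x) = 0" for x y
    using assms(1)[of "x + y"] by (simp add: assms ip_add_left ip_add_right add.commute)
  have "\<i> *\<^sub>C (ip x (Q y) - ip y (Q x)) = 0"
    using 1[of x "\<i> *\<^sub>C y"]
    by (simp add: assms ip_scaleC_left ip_scaleC_right complex_vector.scale_right_diff_distrib)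
  then have "ip x (Q y) = ip y (Q x)" by simp
  with 1[of x y] have "2 *\<^sub>R ip x (Q y) = 0" by (simp add: scaleR_2)
  then show "ip x (Q y) = ip x 0" by simp
qed

section \<open>The operator \<open>I - U\<^sup>*U\<close> and the two implications\<close>

context
  fixes v :: "nat \<Rightarrow> 'a \<Rightarrow> 'x" and B :: real
  assumes v: "\<And>n. v n \<in> mult_module ip" and B: "bessel_bound ip v B"
begin

definition defect :: "'x \<Rightarrow> 'x" where
  "defect x = x - synthesis_op ip v (analysis_op ip v x)"

lemma ip_defect: "ip x (defect y) = ip x y - (\<Sum>n. star (madj ip (v n) x) * madj ip (v n) y)"
  using frame_operator_sums[OF v B] by (simp add: defect_def ip_diff_right sums_iff)

lemma ip_defect_self: "ip x (defect x) = ip x x - (\<Sum>n. frame_term ip v x n)"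
  by (simp add: ip_defect frame_term_eq[abs_def])

lemma defect_sym: "ip (defect x) y = ip x (defect y)"
proof -
  have "ip (defect x) y = star (ip y (defect x))" by (simp add: ip_star)
  also have "star (ip y (synthesis_op ip v (analysis_op ip v x))) = ip x (synthesis_op ip v (analysis_op ip v y))"
    using bounded_linear.sums[OF bounded_linear_star frame_operator_sums[OF v B, of y x]]
      frame_operator_sums[OF v B, of x y]
    by (simp add: star_mult star_star sums_iff)
  then have "star (ip y (defect x)) = ip x (defect y)"
    by (simp add: defect_def ip_diff_right star_diff ip_star)
  finally show ?thesis .
qed

lemma defect_lin:
  "defect (x + y) = defect x + defect y" "defect (c *\<^sub>C x) = c *\<^sub>C defect x"
  "defect (r *\<^sub>R x) = r *\<^sub>R defect x"
  by (rule ip_eqI; simp add: defect_sym[symmetric] ip_add_right ip_scaleC_right ip_scaleR_right)+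

lemma frame_operator_of_finite_extension:
  assumes "finite_extension act ip v N f"
  shows "\<exists>\<theta>\<in>finite_rank (mult_module ip) mult_act (mult_ip ip). \<forall>x. mult_embed act (defect x) = \<theta> (mult_embed act x)"
    and "optimal_bessel_bound ip v \<le> 1"
proof -
  have f: "f i \<in> mult_module ip" if "i < N" for i
    using assms that by (simp add: finite_extension_def)
  have "frame_term ip (prepend N f v) x sums ip x x" for x
    using assms by (auto simp: finite_extension_def parseval_frame_def outer_parseval_frame_def parseval_identity_def)
  then have "(\<lambda>n. frame_term ip (prepend N f v) x (n + N)) sums
      (ip x x - (\<Sum>i<N. frame_term ip (prepend N f v) x i))" for x
    by (rule sums_split_initial_segment)
  \<comment> \<open>Past the first \<open>N\<close> terms the extended sequence is \<open>v\<close>,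
    so its frame sum misses \<open>ip x x\<close> by exactly the terms of \<open>f\<close>.\<close>
  then have sums: "frame_term ip v x sums (ip x x - (\<Sum>i<N. frame_term ip f x i))" for x
    by (simp add: frame_term_def[abs_def] prepend_def)
  have "bessel_bound ip v 1"
    unfolding bessel_bound_def cle_def
  proof (intro conjI allI)
    fix x
    show "summable (frame_term ip v x)" using sums by (rule sums_summable)
    show "cpos (1 *\<^sub>R ip x x - (\<Sum>n. frame_term ip v x n))"
      unfolding sums_unique[OF sums, symmetric]
      by (simp add: frame_term_eq cpos_sum cpos_star_mult)
  qed simp
  then show "optimal_bessel_bound ip v \<le> 1" by (rule optimal_bessel_bound_le)
  define R where "R x = (\<Sum>i<N. f i (madj ip (f i) x))" for x
  have ipR: "ip x (R y) = (\<Sum>i<N. star (madj ip (f i) x) * madj ip (f i) y)" for x y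
    unfolding R_def by (rule ip_theta_sum[OF f])
  have R_lin: "R (x + y) = R x + R y" "R (c *\<^sub>C x) = c *\<^sub>C R x" for x y c
    by (rule ip_eqI; simp add: ipR ip_add_right ip_scaleC_right madj_lin[OF f] mult_scaleC_right
        distrib_left sum.distrib complex_vector.scale_sum_right)+
  have "defect x - R x = 0" for x
  proof (rule polarization[of "\<lambda>x. defect x - R x"])
    show "ip x (defect x - R x) = 0" for x
      using sums_unique[OF sums[of x]]
      by (simp add: ip_diff_right ip_defect_self ipR frame_term_eq[of f]
          diff_eq_eq eq_diff_eq add.commute)
  qed (simp_all add: defect_lin R_lin complex_vector.scale_right_diff_distrib)
  then have dR: "defect x = R x" for x by simp
  let ?\<theta> = "\<Sum>i<N. rank_one mult_act (mult_ip ip) (f i) (f i)"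
  have "?\<theta> \<in> finite_rank (mult_module ip) mult_act (mult_ip ip)"
    unfolding finite_rank_def
    by (intro complex_vector.span_sum complex_vector.span_base) (use f in auto)
  \<comment> \<open>The induction runs over \<open>M \<le> N\<close> because \<open>f i\<close> is
    known to be adjointable only for \<open>i < N\<close>.\<close>
  moreover have "mult_embed act (\<Sum>i<M. f i (madj ip (f i) x))
      = (\<Sum>i<M. rank_one mult_act (mult_ip ip) (f i) (f i)) (mult_embed act x)" if "M \<le> N" for M x
    using that by (induction M) (simp_all add: embed_0 embed_add rank_one_embed f)
  then have "mult_embed act (defect x) = ?\<theta> (mult_embed act x)" for x
    by (simp add: dR R_def)
  ultimately show "\<exists>\<theta>\<in>finite_rank (mult_module ip) mult_act (mult_ip ip).
      \<forall>x. mult_embed act (defect x) = \<theta> (mult_embed act x)" by blast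
qed

lemma finite_extension_of_finite_rank:
  assumes \<theta>: "\<theta> \<in> finite_rank (mult_module ip) mult_act (mult_ip ip)"
    "\<And>x. mult_embed act (defect x) = \<theta> (mult_embed act x)"
    and "optimal_bessel_bound ip v \<le> 1"
  shows "\<exists>N f. finite_extension act ip v N f"
proof -
  have pos: "cpos (ip x (defect x))" for x
    using optimal_bessel_bound_le_oneD[OF B assms(3)] by (simp add: ip_defect_self)
  have sm: "summable (frame_term ip v x)" for x using B by (simp add: bessel_bound_def)
  have le: "cpos (ip x x - ip x (defect x))" for x
    using cpos_suminf_minus_sum[OF sm[of x], of "{}"]
    by (simp add: ip_defect_self frame_term_eq cpos_star_mult)
  \<comment> \<open>\<open>defect\<close> lies between 0 and 1, so it is a contraction and can be
    treated as a bounded operator \<open>T\<close>.\<close>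
  have bl: "bounded_linear defect"
    using contraction_of_cpos[OF defect_sym pos le]
    by (intro bounded_linear_intro[of _ 1]) (simp_all add: defect_lin)
  obtain T where T: "blinfun_apply T = defect"
    using bounded_linear_Blinfun_apply[OF bl] by (rule that)
  obtain N w z where wz: "\<And>i. i < N \<Longrightarrow> w i \<in> mult_module ip" "\<And>i. i < N \<Longrightarrow> z i \<in> mult_module ip"
    "\<And>x. \<theta> (mult_embed act x) = mult_embed act (\<Sum>i<(N::nat). w i (madj ip (z i) x))"
    using finite_rank_embed[OF \<theta>(1)] by blast
  \<comment> \<open>Injectivity of the embedding brings the identity for \<open>\<theta>\<close>
    back to the module.\<close>
  have Tx: "T x = (\<Sum>i<N. w i (madj ip (z i) x))" for x
    using \<theta>(2)[of x] by (simp add: T wz(3) embed_inject)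
  have saT: "sa T" by (simp add: sa_def T defect_sym)
  have posT: "cpos (ip x (T x))" for x by (simp add: T pos)
  obtain M f where f: "\<And>i. i < M \<Longrightarrow> f i \<in> mult_module ip"
    "\<And>x. ip x (T x) = (\<Sum>i<M. frame_term ip f x i)"
    using pos_finite_rank_factor[OF wz(1,2) saT posT Tx] by blast
  have "frame_term ip (prepend M f v) x sums ip x x" for x
  proof -
    have "(\<lambda>n. frame_term ip (prepend M f v) x (n + M)) sums (\<Sum>n. frame_term ip v x n)"
      using summable_sums[OF sm] by (simp add: frame_term_def[abs_def] prepend_def)
    then have "frame_term ip (prepend M f v) x sums
        ((\<Sum>n. frame_term ip v x n) + (\<Sum>i<M. frame_term ip (prepend M f v) x i))"
      by (simp add: sums_iff_shift)
    also have "(\<Sum>i<M. frame_term ip (prepend M f v) x i) = ip x (defect x)"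
      using f(2)[of x] by (simp add: T frame_term_def prepend_def)
    finally show ?thesis by (simp add: ip_defect_self)
  qed
  then have "parseval_identity ip (prepend M f v)" by (simp add: parseval_identity_def)
  moreover have "prepend M f v n \<in> mult_module ip" for n
    using f(1) v by (simp add: prepend_def)
  \<comment> \<open>Whether all terms lie in the range of the embedding decides between a Parseval
    frame and an outer one.\<close>
  ultimately have "finite_extension act ip v M f"
    using f(1) by (auto simp: finite_extension_def parseval_frame_def outer_parseval_frame_def
        inner_seq_def outer_seq_def)
  then show ?thesis by blast
qed

end

end

theorem theorem6p7:
  fixes act :: "'x::complex_banach \<Rightarrow> 'a::cstar_algebra \<Rightarrow> 'x"
    and ip :: "'x \<Rightarrow> 'x \<Rightarrow> 'a"
    and v :: "nat \<Rightarrow> 'a \<Rightarrow> 'x"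
  assumes "hilbert_module act ip"
    and "bessel_sequence act ip v \<or> outer_bessel_sequence act ip v"
  shows "(\<exists>N f. finite_extension act ip v N f) \<longleftrightarrow>
    (\<exists>\<theta>\<in>finite_rank (mult_module ip) mult_act (mult_ip ip).
        \<forall>x. mult_embed act (x - synthesis_op ip v (analysis_op ip v x)) = \<theta> (mult_embed act x)) \<and>
    optimal_bessel_bound ip v \<le> 1"
proof -
  interpret hilbert_module act ip by fact
  have v: "v n \<in> mult_module ip" for n
    using assms(2) embed_mem
    by (auto simp: bessel_sequence_def outer_bessel_sequence_def inner_seq_def outer_seq_def) (metis imageE)
  obtain B where B: "bessel_bound ip v B"
    using assms(2) by (auto simp: bessel_sequence_def outer_bessel_sequence_def)
  show ?thesis
    using frame_operator_of_finite_extension[OF v B] finite_extension_of_finite_rank[OF v B]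
    unfolding defect_def[OF v B] by blast
qed

end
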